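(* Let $N\ge 2$ agents cooperatively solve $\min_{x\in\mathbb{R}^p} f(x):=\frac1N\sum_{i=1}^N f_i(x)$, where each $f_i:\mathbb{R}^p\to\mathbb{R}$ is twice differentiable and satisfies $\mu I_p\preceq \nabla^2 f_i(x)\preceq L I_p$ for all $x\in\mathbb{R}^p$, and $\|\nabla f_i(x)-\nabla f_i(y)\|\le L\|x-y\|$ for all $x,y$, with constants $0<\mu<L$; let $\kappa:=L/\mu>1$ and let $x^\ast$ be the minimizer of $f$. Let $W=[w_{ij}]\in\mathbb{R}^{N\times N}$ be a nonnegative doubly stochastic matrix with $w_{ii}>0$ for all $i$, and set $\varsigma:=\|W-I_N\|_2$, $\sigma:=\|W-\frac1N\mathbf{1}\mathbf{1}^\top\|_2$, assumed to satisfy $\sigma<1$, and $\bar\sigma:=1-\sigma$. Consider the algorithm (with step-size $\alpha>0$ and momentum coefficient $\beta>0$) described in the context, with error vector $\mathbf{e}(t)=(e_1(t),e_2(t),e_3(t),e_4(t))$ as defined there. Let $\epsilon=(\epsilon_1,\epsilon_2,\epsilon_3,\epsilon_4)$ with $\epsilon_i>0$ for each $i\in\{1,2,3,4\}$ be such that $$0<\epsilon_1<\min\Big\{\frac{\bar\sigma\epsilon_2}{L\varsigma},\ \frac{\epsilon_3}{\kappa^2}-\frac{\epsilon_2}{\mu\kappa},\ \frac{\epsilon_4}{\varsigma}\Big\}.$$ Define $\tilde\epsilon:=\kappa(\epsilon_1+\epsilon_3)+\frac{\epsilon_2}{\mu}$ and $\bar\epsilon:=L\kappa(\epsilon_1+\epsilon_3)+\kappa\epsilon_2$.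 If $(\alpha,\beta)$ satisfy $$0<\alpha<\min\Big\{\frac1\kappa,\ \frac{\bar\sigma\epsilon_1}{\tilde\epsilon},\ \frac{\bar\sigma\epsilon_2-L\varsigma\epsilon_1}{\bar\epsilon},\ \frac{\epsilon_4-\varsigma\epsilon_1}{\tilde\epsilon}\Big\},$$ $$0<\beta<\min\Big\{\frac{\tilde\epsilon}{\epsilon_4}\Big(\frac{\bar\sigma\epsilon_1}{\tilde\epsilon}-\alpha\Big),\ \frac{\bar\epsilon}{L\epsilon_4}\Big(\frac{\bar\sigma\epsilon_2-L\varsigma\epsilon_1}{\bar\epsilon}-\alpha\Big),\ \frac{\alpha}{\epsilon_4}\Big(\frac{\epsilon_3}{\kappa}-\kappa\epsilon_1-\frac{\epsilon_2}{\mu}\Big),\ \frac{\tilde\epsilon}{\epsilon_4}\Big(\frac{\epsilon_4-\varsigma\epsilon_1}{\tilde\epsilon}-\alpha\Big)\Big\},$$ then the spectral radius of the matrix $$A(\alpha,\beta)=\begin{pmatrix}\sigma+\alpha\kappa & \frac{\alpha}{\mu} & \alpha\kappa & \beta\\ L(\varsigma+\alpha\kappa) & \sigma+\alpha\kappa & L\alpha\kappa & L\beta\\ \alpha\kappa & \frac{\alpha}{\mu} & 1-\frac{\alpha}{\kappa} & \beta\\ \varsigma+\alpha\kappa & \frac{\alpha}{\mu} & \alpha\kappa & \beta\end{pmatrix}$$ satisfies $\rho(A(\alpha,\beta))<1$, and for every initialization, $\mathbf{e}(t)\to 0$ as $t\to\infty$ at a linear rate $O\big(\rho(A(\alpha,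\beta))^t\big)$.
   Context: Algorithm (for $t=0,1,2,\dots$, at each agent $i$, with $\mathcal{N}_i=\{j\neq i: w_{ij}>0\}$): $x_i(t+1)=\sum_{j\in\mathcal{N}_i\cup\{i\}} w_{ij}x_j(t)-\alpha d_i(t)+\beta v_i(t)$; $g_i(t+1)=\nabla f_i(x_i(t+1))-\nabla f_i(x_i(t))$; $y_i(t+1)=\sum_{j\in\mathcal{N}_i\cup\{i\}}w_{ij}y_j(t)+g_i(t+1)$; $v_i(t+1)=x_i(t+1)-x_i(t)$; $d_i(t)=[\nabla^2 f_i(x_i(t))]^{-1}y_i(t)$; initialized with arbitrary $x_i(0)$, $y_i(0)=\nabla f_i(x_i(0))$, $v_i(0)=0$ (i.e. $x_i(-1)=x_i(0)$). Matrix notation: $X(t),Y(t),V(t),D(t)\in\mathbb{R}^{N\times p}$ have $i$-th rows $x_i(t)^\top, y_i(t)^\top, v_i(t)^\top, d_i(t)^\top$; $\mathbf{1}\in\mathbb{R}^N$ is the all-ones vector; $\bar x(t)=\frac1N\mathbf{1}^\top X(t)$, $\bar y(t)=\frac1N\mathbf{1}^\top Y(t)$ (row vectors). Vector norms are Euclidean, matrix norms $\|\cdot\|$ are Frobenius, $\|\cdot\|_2$ is the spectral norm, $\rho(\cdot)$ the spectral radius. Errors: $e_1(t)=\|X(t)-\mathbf{1}\bar x(t)\|$, $e_2(t)=\|Y(t)-\mathbf{1}\bar y(t)\|$, $e_3(t)=\sqrt N\|\bar x(t)^\top-x^\ast\|$, $e_4(t)=\|X(t)-X(t-1)\|$. 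*)

theory Defs
  imports "HOL-Analysis.Analysis" "Jordan_Normal_Form.Spectral_Radius"
begin

no_notation Matrix.vec_index (infixl "$" 100)


definition A_mat :: "real \<Rightarrow> real \<Rightarrow> real \<Rightarrow> real \<Rightarrow> real \<Rightarrow> real \<Rightarrow> real \<Rightarrow> real Matrix.mat" where
  "A_mat sig vsig L mu kap alpha beta = mat_of_rows_list 4
     [[sig + alpha * kap, alpha / mu, alpha * kap, beta],
      [L * (vsig + alpha * kap), sig + alpha * kap, L * alpha * kap, L * beta],
      [alpha * kap, alpha / mu, 1 - alpha / kap, beta],
      [vsig + alpha * kap, alpha / mu, alpha * kap, beta]]"

definition real_spectral_radius :: "real Matrix.mat \<Rightarrow> real" where
  "real_spectral_radius M = spectral_radius (map_mat complex_of_real M)"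

definition spec_norm :: "real^'n^'m \<Rightarrow> real" where
  "spec_norm M = onorm (\<lambda>v. M *v v)"

text \<open>Frobenius norm of an N x p matrix given by its rows.\<close>
definition frob :: "('n::finite \<Rightarrow> real^'p) \<Rightarrow> real" where
  "frob X = sqrt (\<Sum>i\<in>UNIV. (norm (X i))\<^sup>2)"

end

theory Submission
  imports Defs
begin

no_notation scalar_prod (infix "\<bullet>" 70)

text \<open>The damped Newton direction at the average iterate is \<open>M g\<close>, where \<open>g\<close> is the gradient of the
  averaged objective \<open>F\<close> and \<open>M\<close> is the average of the inverse Hessians. Since \<open>M\<close> need not commute
  with the Hessian of \<open>F\<close>, the step \<open>z - \<alpha> M g\<close> need not decrease the Euclidean distance to the
  minimizer. It does contract \<open>sqrt (2 (F z - F xstar) / L)\<close> by the factor \<open>1 - \<alpha> / \<kappa>\<close>. This function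
  is also 1-Lipschitz and dominates \<open>norm (g z) / L\<close>, so it can replace the third error component:
  the modified error vector satisfies \<open>e (t + 1) \<le> A e t\<close> entrywise. As \<open>A\<close> is positive, it has a
  positive eigenvector by Brouwer's theorem, whose eigenvalue is the spectral radius; comparison
  with it gives the exact rate, and \<open>A \<epsilon> < \<epsilon>\<close> gives that the spectral radius is below 1. The original
  third component is recovered up to the factor \<open>sqrt \<kappa>\<close>.\<close>

section \<open>Smooth strongly convex functions\<close>

text \<open>Strong convexity and smoothness as two quadratic bounds, which force \<open>g\<close> to
  be the gradient. In this form they pass to averages, and a quadratic can be split off, without
  differentiating.\<close>

definition sandwiched :: "real \<Rightarrow> real \<Rightarrow> ('a::real_inner \<Rightarrow> real) \<Rightarrow> ('a \<Rightarrow> 'a) \<Rightarrow> bool" where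
  "sandwiched m M F g \<longleftrightarrow>
     (\<forall>z z'. F z + g z \<bullet> (z' - z) + m / 2 * (norm (z' - z))\<^sup>2 \<le> F z' \<and>
            F z' \<le> F z + g z \<bullet> (z' - z) + M / 2 * (norm (z' - z))\<^sup>2)"

lemma sandwichedD:
  assumes "sandwiched m M F g"
  shows "F z + g z \<bullet> (z' - z) + m / 2 * (norm (z' - z))\<^sup>2 \<le> F z'"
    and "F z' \<le> F z + g z \<bullet> (z' - z) + M / 2 * (norm (z' - z))\<^sup>2"
  using assms unfolding sandwiched_def by blast+

text \<open>Along the line through \<open>z\<close> in direction \<open>k\<close> this is the
  one-variable Lagrange remainder, which asks the second derivative to exist but not to be
  continuous.\<close>

lemma second_order_Taylor:
  fixes F :: "real^'p \<Rightarrow> real"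
  assumes grad: "\<And>z. (F has_derivative (\<lambda>h. g z \<bullet> h)) (at z)"
    and hess: "\<And>z. (g has_derivative (\<lambda>h. H z *v h)) (at z)"
  shows "\<exists>u. F (z + k) = F z + g z \<bullet> k + (k \<bullet> (H u *v k)) / 2"
proof -
  define D where "D = (\<lambda>m (t::real). if m = (0::nat) then F (z + t *\<^sub>R k)
      else if m = 1 then g (z + t *\<^sub>R k) \<bullet> k else k \<bullet> (H (z + t *\<^sub>R k) *v k))"
  have line: "((\<lambda>t. z + t *\<^sub>R k) has_derivative (\<lambda>s. s *\<^sub>R k)) (at t)" for t
    by (auto intro!: derivative_eq_intros)
  have "((\<lambda>t. F (z + t *\<^sub>R k)) has_derivative (\<lambda>s. g (z + t *\<^sub>R k) \<bullet> (s *\<^sub>R k))) (at t)" for t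
    using has_derivative_compose[OF line grad] by simp
  then have D0: "DERIV (D 0) t :> D 1 t" for t
    unfolding D_def has_field_derivative_def
    by (simp add: mult_commute_abs)
  have "((\<lambda>t. g (z + t *\<^sub>R k)) has_derivative (\<lambda>s. H (z + t *\<^sub>R k) *v (s *\<^sub>R k))) (at t)" for t
    using has_derivative_compose[OF line hess] by simp
  then have "((\<lambda>t. g (z + t *\<^sub>R k) \<bullet> k) has_derivative (\<lambda>s. (H (z + t *\<^sub>R k) *v (s *\<^sub>R k)) \<bullet> k)) (at t)" for t
    by (rule has_derivative_inner_left)
  then have D1: "DERIV (D 1) t :> D 2 t" for t
    unfolding D_def has_field_derivative_def
    by (simp add: matrix_vector_mult_scaleR inner_commute mult_commute_abs)
  have "\<forall>m t. m < 2 \<and> 0 \<le> t \<and> t \<le> 1 \<longrightarrow> DERIV (D m) t :> D (Suc m) t"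
    using D0 D1 by (auto simp: less_Suc_eq numeral_2_eq_2)
  then obtain t where "D 0 1 = (\<Sum>m<2. D m 0 / fact m * 1 ^ m) + D 2 t / fact 2 * 1 ^ 2"
    using Maclaurin2[of 1 D "D 0" 2] by auto
  then have "F (z + k) = F z + g z \<bullet> k + (k \<bullet> (H (z + t *\<^sub>R k) *v k)) / 2"
    by (simp add: D_def numeral_2_eq_2)
  then show ?thesis by blast
qed

lemma sandwiched_if_hessian_bounds:
  fixes F :: "real^'p \<Rightarrow> real"
  assumes grad: "\<And>z. (F has_derivative (\<lambda>h. g z \<bullet> h)) (at z)"
    and hess: "\<And>z. (g has_derivative (\<lambda>h. H z *v h)) (at z)"
    and lower: "\<And>z h. m * (norm h)\<^sup>2 \<le> h \<bullet> (H z *v h)"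
    and upper: "\<And>z h. h \<bullet> (H z *v h) \<le> M * (norm h)\<^sup>2"
  shows "sandwiched m M F g"
  unfolding sandwiched_def
proof (intro allI)
  fix z z' :: "real^'p"
  obtain u where "F (z + (z' - z)) = F z + g z \<bullet> (z' - z) + ((z' - z) \<bullet> (H u *v (z' - z))) / 2"
    using second_order_Taylor[OF grad hess] by blast
  with lower[of "z' - z" u] upper[of "z' - z" u]
  show "F z + g z \<bullet> (z' - z) + m / 2 * (norm (z' - z))\<^sup>2 \<le> F z' \<and>
        F z' \<le> F z + g z \<bullet> (z' - z) + M / 2 * (norm (z' - z))\<^sup>2"
    by simp
qed

text \<open>Both bounds are linear in the pair of function and gradient and share their constants,
  so the averaged objective inherits them.\<close>

lemma sandwiched_mean:
  fixes F :: "'n::finite \<Rightarrow> 'a::real_inner \<Rightarrow> real"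
  assumes "\<And>i. sandwiched m M (F i) (g i)"
  shows "sandwiched m M (\<lambda>z. 1 / real CARD('n) * (\<Sum>i\<in>UNIV. F i z))
           (\<lambda>z. (1 / real CARD('n)) *\<^sub>R (\<Sum>i\<in>UNIV. g i z))"
proof -
  have N: "real CARD('n) > 0" by simp
  have eq: "1 / real CARD('n) * (\<Sum>i\<in>UNIV. F i z) + ((1 / real CARD('n)) *\<^sub>R (\<Sum>i\<in>UNIV. g i z)) \<bullet> k + c
    = 1 / real CARD('n) * (\<Sum>i\<in>UNIV. F i z + g i z \<bullet> k + c)" for z k c
    using N by (simp add: sum.distrib inner_sum_left field_simps)
  show ?thesis
    unfolding sandwiched_def eq
    by (intro allI conjI mult_left_mono sum_mono sandwichedD[OF assms]) auto
qed

text \<open>Reduces strong convexity to plain convexity, where cocoercivity applies. Expanding the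
  quadratic at \<open>z\<close>, its linear part goes into the new gradient and its pure square
  lowers both moduli by \<open>m\<close>. The constant \<open>c\<close> allows the value at the
  minimizer to be normalized to 0.\<close>

lemma sandwiched_minus_quadratic:
  assumes "sandwiched m M F g"
  shows "sandwiched 0 (M - m) (\<lambda>z. F z - c - m / 2 * (norm (z - a))\<^sup>2) (\<lambda>z. g z - m *\<^sub>R (z - a))"
proof -
  have eq: "(norm (z' - a))\<^sup>2 = (norm (z - a))\<^sup>2 + 2 * ((z - a) \<bullet> (z' - z)) + (norm (z' - z))\<^sup>2" for z z'
  proof -
    have "(norm (z' - a))\<^sup>2 = (norm ((z - a) + (z' - z)))\<^sup>2" by simp
    then show ?thesis by (simp only: norm_add_Pythagorean dot_norm) (simp add: field_simps)
  qed
  show ?thesis unfolding sandwiched_def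
  proof (intro allI)
    fix z z'
    show "F z - c - m / 2 * (norm (z - a))\<^sup>2 + (g z - m *\<^sub>R (z - a)) \<bullet> (z' - z) + 0 / 2 * (norm (z' - z))\<^sup>2
           \<le> F z' - c - m / 2 * (norm (z' - a))\<^sup>2 \<and>
          F z' - c - m / 2 * (norm (z' - a))\<^sup>2 \<le> F z - c - m / 2 * (norm (z - a))\<^sup>2 +
            (g z - m *\<^sub>R (z - a)) \<bullet> (z' - z) + (M - m) / 2 * (norm (z' - z))\<^sup>2"
      using sandwichedD(1)[OF assms, of z z'] sandwichedD(2)[OF assms, of z' z]
      unfolding eq[of z' z] inner_diff_left inner_scaleR_left by (simp add: algebra_simps) argo
  qed
qed

text \<open>Tilt \<open>F\<close> by the linear function with slope \<open>g z\<close>: the result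
  is convex with its minimum at \<open>z\<close>. A gradient step of length \<open>1 / M\<close>
  from \<open>z'\<close>, ending at \<open>u\<close>, lowers the tilted function by the squared
  gradient difference over \<open>2 * M\<close> and cannot fall below that minimum.\<close>

lemma sandwiched_cocoercive:
  assumes F: "sandwiched 0 M F g" and M: "0 < M"
  shows "F z + g z \<bullet> (z' - z) + (norm (g z' - g z))\<^sup>2 / (2 * M) \<le> F z'"
proof -
  define r where "r = g z' - g z"
  define u where "u = z' - (1 / M) *\<^sub>R r"
  have 1: "F z + g z \<bullet> (u - z) \<le> F u" using sandwichedD(1)[OF F, of z u] by simp
  have 2: "F u \<le> F z' + g z' \<bullet> (u - z') + M / 2 * (norm (u - z'))\<^sup>2" by (rule sandwichedD(2)[OF F])
  have 3: "M / 2 * (norm (u - z'))\<^sup>2 = (norm r)\<^sup>2 / (2 * M)"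
    using M by (simp add: u_def power_mult_distrib power_divide power2_eq_square)
  have 4: "g z \<bullet> (u - z) = g z \<bullet> (z' - z) - (g z \<bullet> r) / M" "g z' \<bullet> (u - z') = - (g z' \<bullet> r) / M"
    by (simp_all add: u_def inner_diff_right)
  have "(g z' \<bullet> r) / M - (g z \<bullet> r) / M = (norm r)\<^sup>2 / M"
    by (simp add: r_def power2_norm_eq_inner inner_diff_left diff_divide_distrib)
  with 1 2 3 4 have "F z + g z \<bullet> (z' - z) + (norm r)\<^sup>2 / M - (norm r)\<^sup>2 / (2 * M) \<le> F z'"
    by simp
  moreover have "(norm r)\<^sup>2 / M - (norm r)\<^sup>2 / (2 * M) = (norm r)\<^sup>2 / (2 * M)"
    using M by (simp add: field_simps)
  ultimately show ?thesis by (simp add: r_def)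
qed

text \<open>Differentiating cocoercivity of the gradient yields the operator inequality
  \<open>(H - m)(M - H) \<ge> 0\<close> without an appeal to the symmetry of the Hessian.\<close>

lemma hessian_sector:
  fixes F :: "real^'p \<Rightarrow> real"
  assumes F: "sandwiched m M F g" and mM: "m < M"
    and hess: "(g has_derivative (\<lambda>h. H *v h)) (at z)"
  shows "(H *v h - m *\<^sub>R h) \<bullet> (M *\<^sub>R h - H *v h) \<ge> 0"
proof -
  define q where "q = (\<lambda>z. g z - m *\<^sub>R (z - 0))"
  define r where "r = (\<lambda>t::real. (q (z + t *\<^sub>R h) - q z) /\<^sub>R t)"
  have S: "sandwiched 0 (M - m) (\<lambda>z. F z - 0 - m / 2 * (norm (z - 0))\<^sup>2) q"
    unfolding q_def by (rule sandwiched_minus_quadratic[OF F])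
  \<comment> \<open>Adding the cocoercivity inequalities for both orders of the pair cancels the
    function values.\<close>
  have co: "(norm (q z' - q z))\<^sup>2 \<le> (M - m) * ((q z' - q z) \<bullet> (z' - z))" for z'
    using sandwiched_cocoercive[OF S, of z z'] sandwiched_cocoercive[OF S, of z' z] mM
    by (simp add: norm_minus_commute[of "q z"] inner_diff_left inner_diff_right field_simps)
  have pos: "(norm (r t))\<^sup>2 \<le> (M - m) * (r t \<bullet> h)" if "t \<noteq> 0" for t
  proof -
    have "(norm (r t))\<^sup>2 = (norm (q (z + t *\<^sub>R h) - q z))\<^sup>2 / t\<^sup>2"
      by (simp add: r_def power_mult_distrib power_divide divide_inverse mult.commute power_inverse)
    also have "\<dots> \<le> ((M - m) * ((q (z + t *\<^sub>R h) - q z) \<bullet> (t *\<^sub>R h))) / t\<^sup>2"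
      using co[of "z + t *\<^sub>R h"] by (intro divide_right_mono) auto
    also have "\<dots> = (M - m) * (r t \<bullet> h)"
      using that by (simp add: r_def divide_inverse power2_eq_square)
    finally show ?thesis .
  qed
  have "(q has_derivative (\<lambda>h. H *v h - m *\<^sub>R h)) (at z)"
    unfolding q_def using hess by (auto intro!: derivative_eq_intros)
  moreover have "((\<lambda>t. z + t *\<^sub>R h) has_derivative (\<lambda>s. s *\<^sub>R h)) (at 0)"
    by (auto intro!: derivative_eq_intros)
  ultimately have "((\<lambda>t. q (z + t *\<^sub>R h)) has_derivative (\<lambda>s. H *v (s *\<^sub>R h) - m *\<^sub>R (s *\<^sub>R h))) (at 0)"
    using has_derivative_compose[of "\<lambda>t. z + t *\<^sub>R h" "\<lambda>s. s *\<^sub>R h" 0 UNIV q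
        "\<lambda>h. H *v h - m *\<^sub>R h"] by simp
  then have "((\<lambda>t. q (z + t *\<^sub>R h)) has_vector_derivative (H *v h - m *\<^sub>R h)) (at 0)"
    unfolding has_vector_derivative_def
    by (simp add: matrix_vector_mult_scaleR scaleR_diff_right mult.commute)
  then have lim: "(r \<longlongrightarrow> H *v h - m *\<^sub>R h) (at 0)"
  proof -
    assume d: "((\<lambda>t. q (z + t *\<^sub>R h)) has_vector_derivative (H *v h - m *\<^sub>R h)) (at 0)"
    let ?D = "H *v h - m *\<^sub>R h"
    have "((\<lambda>t. norm (q (z + t *\<^sub>R h) - q z - t *\<^sub>R ?D) / norm t) \<longlongrightarrow> 0) (at 0)"
      using d by (simp add: has_vector_derivative_def has_derivative_at)
    moreover have "norm (q (z + t *\<^sub>R h) - q z - t *\<^sub>R ?D) / norm t = norm (r t - ?D)"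
      if "t \<noteq> 0" for t
    proof -
      have "r t - ?D = (q (z + t *\<^sub>R h) - q z - t *\<^sub>R ?D) /\<^sub>R t"
        using that by (simp add: r_def scaleR_diff_right)
      then show ?thesis by (simp add: divide_inverse mult.commute)
    qed
    ultimately have "((\<lambda>t. norm (r t - ?D)) \<longlongrightarrow> 0) (at 0)"
      by (auto elim!: Lim_transform_eventually simp: eventually_at_filter)
    then show ?thesis using Lim_null tendsto_norm_zero_iff by blast
  qed
  \<comment> \<open>The bound \<open>pos\<close> survives the limit of the difference quotients
    \<open>r t\<close>. With \<open>D = H h - m h\<close> it says
    \<open>D \<bullet> ((M - m) h - D) \<ge> 0\<close>, and the second factor is
    \<open>M h - H h\<close>.\<close>
  have "(norm (H *v h - m *\<^sub>R h))\<^sup>2 \<le> (M - m) * ((H *v h - m *\<^sub>R h) \<bullet> h)"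
  proof (rule tendsto_le)
    show "((\<lambda>t. (M - m) * (r t \<bullet> h)) \<longlongrightarrow> (M - m) * ((H *v h - m *\<^sub>R h) \<bullet> h)) (at 0)"
      by (intro tendsto_intros lim)
    show "((\<lambda>t. (norm (r t))\<^sup>2) \<longlongrightarrow> (norm (H *v h - m *\<^sub>R h))\<^sup>2) (at 0)"
      by (intro tendsto_intros lim)
  qed (auto simp: eventually_at_filter pos)
  then show ?thesis
    by (simp add: power2_norm_eq_inner inner_simps algebra_simps)
qed

text \<open>Write \<open>F = F xs + \<mu> / 2 * (norm (z - xs))\<^sup>2 + h z\<close> with \<open>h\<close> convex and \<open>(L - \<mu>)\<close>-smooth. The value
  \<open>h x'\<close> is bounded by the convex combination, with weights \<open>1 - \<theta>\<close> and \<open>\<theta>\<close>, of the interpolation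
  inequalities for the pairs \<open>(x, x')\<close> and \<open>(xs, x')\<close>. What remains is a quadratic form in \<open>Q\<close>, \<open>r\<close>
  and \<open>k\<close>, the excess of the step over a gradient step of length \<open>a / L\<close>.\<close>

lemma preconditioned_step_contracts:
  fixes x :: "'a::real_inner"
  assumes F: "sandwiched \<mu> L F g" and mu: "0 < \<mu>" "\<mu> < L"
    and crit: "g xs = 0"
    and sector: "0 \<le> (g x - \<mu> *\<^sub>R u) \<bullet> (L *\<^sub>R u - g x)"
    and a: "0 < a" "2 * a * L \<le> \<mu>"
  shows "F (x - a *\<^sub>R u) - F xs \<le> (1 - a * \<mu> / L)\<^sup>2 * (F x - F xs)"
proof -
  define h where "h = (\<lambda>z. F z - F xs - \<mu> / 2 * (norm (z - xs))\<^sup>2)"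
  define q where "q = (\<lambda>z. g z - \<mu> *\<^sub>R (z - xs))"
  have S: "sandwiched 0 (L - \<mu>) h q"
    unfolding h_def q_def by (rule sandwiched_minus_quadratic[OF F])
  have Lm: "0 < L - \<mu>" "0 < L" using mu by auto
  define s where "s = a / L"
  define \<theta> where "\<theta> = s * \<mu>"
  define X where "X = x - xs"
  define Q where "Q = q x"
  define x' where "x' = x - a *\<^sub>R u"
  define r where "r = q x' - Q"
  define k where "k = a *\<^sub>R u - s *\<^sub>R g x"
  \<comment> \<open>The step splits as \<open>a u = \<theta> X + w\<close>, where
    \<open>\<theta> = a * \<mu> / L\<close> is the promised contraction: \<open>\<theta> X\<close>
    comes from the quadratic part of \<open>g x\<close>, and \<open>w\<close> from \<open>Q\<close>
    and \<open>k\<close>.\<close>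
  define w where "w = s *\<^sub>R Q + k"
  have s: "0 < s" "s * L = a" using a Lm by (auto simp: s_def)
  have a2: "a \<le> 1 / 2"
  proof -
    have "2 * a * L \<le> 1 * L" using a mu by linarith
    then show ?thesis using Lm by simp
  qed
  have th: "0 < \<theta>" "\<theta> \<le> 1 / 2"
  proof -
    show "0 < \<theta>" using s mu by (simp add: \<theta>_def)
    have "s * \<mu> \<le> s * L" using s mu by (intro mult_left_mono) auto
    then show "\<theta> \<le> 1 / 2" using s a2 by (simp add: \<theta>_def)
  qed
  have gx: "g x = \<mu> *\<^sub>R X + Q" by (simp add: Q_def q_def X_def)
  have step: "a *\<^sub>R u = \<theta> *\<^sub>R X + w"
    by (simp add: w_def k_def gx \<theta>_def algebra_simps)
  have hxs: "h xs = 0" and qxs: "q xs = 0" by (simp_all add: h_def q_def crit)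
  have i: "h x' \<le> h x - (Q + r) \<bullet> (\<theta> *\<^sub>R X + w) - (norm r)\<^sup>2 / (2 * (L - \<mu>))"
    using sandwiched_cocoercive[OF S Lm(1), of x' x]
    by (simp add: x'_def[symmetric] step[symmetric] r_def Q_def[symmetric] norm_minus_commute)
       (simp add: x'_def r_def Q_def)
  have ii: "h x' \<le> (Q + r) \<bullet> (X - (\<theta> *\<^sub>R X + w))"
  proof -
    have "h x' + q x' \<bullet> (xs - x') \<le> 0"
      using sandwichedD(1)[OF S, of x' xs] hxs by simp
    moreover have "xs - x' = - (X - (\<theta> *\<^sub>R X + w))"
      by (simp add: x'_def step X_def)
    then have "q x' \<bullet> (xs - x') = - (q x' \<bullet> (X - (\<theta> *\<^sub>R X + w)))"
      by (simp only: inner_minus_right)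
    ultimately show ?thesis by (simp add: r_def)
  qed
  have iii: "h x \<le> Q \<bullet> X"
    using sandwichedD(1)[OF S, of x xs] hxs
    by (simp add: Q_def[symmetric] X_def inner_diff_right)
  \<comment> \<open>The sector condition in terms of \<open>k\<close>: its second factor is a
    multiple of \<open>k\<close>, its first a combination of \<open>g x\<close> and
    \<open>k\<close>. The factor \<open>1 - \<mu> / L\<close> may be dropped once
    \<open>k \<bullet> g x \<ge> 0\<close> is known.\<close>
  have kg: "(\<mu> / a) * (norm k)\<^sup>2 \<le> k \<bullet> g x"
  proof -
    have u: "u = (1 / a) *\<^sub>R (k + s *\<^sub>R g x)" using a by (simp add: k_def)
    have e1: "L *\<^sub>R u - g x = (L / a) *\<^sub>R k"
      using a s Lm by (simp add: u scaleR_add_right s_def)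
    have e2: "g x - \<mu> *\<^sub>R u = (1 - \<mu> / L) *\<^sub>R g x - (\<mu> / a) *\<^sub>R k"
      using a Lm by (simp add: u s_def algebra_simps)
    have "0 \<le> (L / a) * ((1 - \<mu> / L) * (k \<bullet> g x) - (\<mu> / a) * (norm k)\<^sup>2)"
      using sector unfolding e1 e2
      by (simp only: inner_scaleR_right inner_diff_left inner_scaleR_left power2_norm_eq_inner
          inner_commute[of k "g x"])
    then have *: "(\<mu> / a) * (norm k)\<^sup>2 \<le> (1 - \<mu> / L) * (k \<bullet> g x)"
      using mult_le_cancel_left_pos[of "L / a" 0] a Lm by simp
    moreover have "0 \<le> (\<mu> / a) * (norm k)\<^sup>2" using a mu by simp
    ultimately have "0 \<le> (1 - \<mu> / L) * (k \<bullet> g x)" by linarith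
    moreover have "0 < 1 - \<mu> / L" using mu by simp
    ultimately have "0 \<le> k \<bullet> g x" by (simp add: zero_le_mult_iff)
    then have "0 \<le> \<mu> / L * (k \<bullet> g x)" using mu by simp
    with * show ?thesis by (simp add: algebra_simps)
  qed
  \<comment> \<open>The total coefficient of \<open>(norm w)\<^sup>2\<close>:
    \<open>L - \<mu>\<close> from eliminating \<open>r\<close>, and \<open>\<mu> / 2\<close> from
    the split-off quadratic.\<close>
  define T where "T = L - \<mu> / 2"
  \<comment> \<open>The step bound gives \<open>\<mu> / a \<ge> 2 * L\<close>, while
    \<open>\<theta> * (\<mu> / a) = \<mu>\<^sup>2 / L\<close> is at most \<open>\<mu>\<close>; the
    difference is at least \<open>2 * T\<close>.\<close>
  have kk: "2 * T * (norm k)\<^sup>2 \<le> (1 - \<theta>) * (k \<bullet> g x)"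
  proof -
    have "2 * L \<le> \<mu> / a" using a by (simp add: field_simps)
    moreover have "\<theta> * (\<mu> / a) \<le> \<mu>"
      using a mu by (simp add: \<theta>_def s_def field_simps)
    ultimately have "2 * T \<le> (1 - \<theta>) * (\<mu> / a)" unfolding T_def left_diff_distrib by simp
    then have "2 * T * (norm k)\<^sup>2 \<le> (1 - \<theta>) * (\<mu> / a) * (norm k)\<^sup>2"
      by (intro mult_right_mono) auto
    also have "\<dots> \<le> (1 - \<theta>) * (k \<bullet> g x)"
      using mult_left_mono[OF kg, of "1 - \<theta>"] th by (simp add: mult.assoc)
    finally show ?thesis .
  qed
  \<comment> \<open>Completing the square eliminates \<open>r\<close>; since
    \<open>\<theta> \<le> 1 / 2\<close>, at least half of the cocoercivity term is available for
    it.\<close>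
  have rw: "- (r \<bullet> w) - (1 - \<theta>) * ((norm r)\<^sup>2 / (2 * (L - \<mu>))) \<le> (L - \<mu>) * (norm w)\<^sup>2"
  proof -
    have "0 \<le> (norm (r + (2 * (L - \<mu>)) *\<^sub>R w))\<^sup>2 / (4 * (L - \<mu>))" using Lm by simp
    also have "\<dots> = (norm r)\<^sup>2 / (4 * (L - \<mu>)) + r \<bullet> w + (L - \<mu>) * (norm w)\<^sup>2"
      using Lm by (simp add: power2_norm_eq_inner inner_simps inner_commute field_simps)
    finally have "- (r \<bullet> w) - (norm r)\<^sup>2 / (4 * (L - \<mu>)) \<le> (L - \<mu>) * (norm w)\<^sup>2" by simp
    moreover have "(norm r)\<^sup>2 / (4 * (L - \<mu>)) \<le> (1 - \<theta>) * ((norm r)\<^sup>2 / (2 * (L - \<mu>)))"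
    proof -
      have "(1 / 2) * ((norm r)\<^sup>2 / (2 * (L - \<mu>))) \<le> (1 - \<theta>) * ((norm r)\<^sup>2 / (2 * (L - \<mu>)))"
        using th Lm by (intro mult_right_mono) auto
      then show ?thesis by simp
    qed
    ultimately show ?thesis by linarith
  qed
  \<comment> \<open>The remaining quadratic form in \<open>Q\<close> and \<open>k\<close>.
    Completing the square in \<open>k\<close> leaves a multiple of \<open>(norm Q)\<^sup>2\<close>
    whose sign is settled by \<open>s * L = a \<le> 1 / 2\<close>.\<close>
  have final: "T * (norm w)\<^sup>2 \<le> 2 * T * (norm k)\<^sup>2 + \<theta> * (Q \<bullet> k) + s * (norm Q)\<^sup>2"
  proof -
    have T: "0 < T" "L - \<mu> \<le> T" "T \<le> L" using mu by (auto simp: T_def)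
    have w2: "(norm w)\<^sup>2 = s\<^sup>2 * (norm Q)\<^sup>2 + 2 * s * (Q \<bullet> k) + (norm k)\<^sup>2"
      unfolding w_def power2_norm_eq_inner
      by (simp add: inner_add_left inner_add_right inner_commute power2_eq_square algebra_simps)
    have "0 \<le> T * (norm (k - (s * (L - \<mu>) / T) *\<^sub>R Q))\<^sup>2" using T by simp
    also have "\<dots> = T * (norm k)\<^sup>2 - 2 * s * (L - \<mu>) * (Q \<bullet> k) + s * (s * (L - \<mu>)\<^sup>2 / T) * (norm Q)\<^sup>2"
      unfolding power2_norm_eq_inner using T
      by (simp add: inner_diff_left inner_diff_right inner_commute field_simps power2_eq_square)
    finally have 1: "0 \<le> T * (norm k)\<^sup>2 - 2 * s * (L - \<mu>) * (Q \<bullet> k) + s * (s * (L - \<mu>)\<^sup>2 / T) * (norm Q)\<^sup>2" .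
    have "s * (L - \<mu>)\<^sup>2 / T \<le> s * (L - \<mu>)"
    proof -
      have "s * (L - \<mu>) * (L - \<mu>) \<le> s * (L - \<mu>) * T" using s Lm T by (intro mult_left_mono) auto
      then show ?thesis using T by (simp add: power2_eq_square pos_divide_le_eq mult.assoc)
    qed
    also have "\<dots> \<le> 1 - s * T"
    proof -
      have "s * (L - \<mu>) \<le> s * L" "s * T \<le> s * L" using s mu T by (auto intro!: mult_left_mono)
      then show ?thesis using s a2 by linarith
    qed
    finally have "s * (s * (L - \<mu>)\<^sup>2 / T) * (norm Q)\<^sup>2 \<le> s * (1 - s * T) * (norm Q)\<^sup>2"
      using s by (intro mult_right_mono mult_left_mono) auto
    with 1 have "0 \<le> T * (norm k)\<^sup>2 - 2 * s * (L - \<mu>) * (Q \<bullet> k) + s * (1 - s * T) * (norm Q)\<^sup>2"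
      by linarith
    then show ?thesis unfolding w2 \<theta>_def
      by (simp add: T_def algebra_simps power2_eq_square)
  qed
  have hx': "h x' \<le> (1 - \<theta>) * (h x - (Q + r) \<bullet> (\<theta> *\<^sub>R X + w) - (norm r)\<^sup>2 / (2 * (L - \<mu>)))
       + \<theta> * ((Q + r) \<bullet> (X - (\<theta> *\<^sub>R X + w)))"
  proof -
    have "h x' = (1 - \<theta>) * h x' + \<theta> * h x'" by (simp add: algebra_simps)
    also have "\<dots> \<le> (1 - \<theta>) * (h x - (Q + r) \<bullet> (\<theta> *\<^sub>R X + w) - (norm r)\<^sup>2 / (2 * (L - \<mu>)))
       + \<theta> * ((Q + r) \<bullet> (X - (\<theta> *\<^sub>R X + w)))"
      using i ii th by (intro add_mono mult_left_mono) auto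
    finally show ?thesis .
  qed
  \<comment> \<open>The weights \<open>1 - \<theta>\<close> and \<open>\<theta>\<close> are those
    for which the terms with \<open>X\<close> cancel.\<close>
  have "\<dots> = (1 - \<theta>) * h x - (Q + r) \<bullet> w - (1 - \<theta>) * ((norm r)\<^sup>2 / (2 * (L - \<mu>)))"
    by (simp add: inner_simps algebra_simps)
  with hx' have 1: "h x' \<le> (1 - \<theta>) * h x - (Q + r) \<bullet> w - (1 - \<theta>) * ((norm r)\<^sup>2 / (2 * (L - \<mu>)))" by simp
  \<comment> \<open>Convexity is spent on a fraction \<open>\<theta>\<close> of
    \<open>(1 - \<theta>) * h x\<close> only; the resulting \<open>Q \<bullet> X\<close> cancels
    against the one in \<open>4\<close>.\<close>
  have 2: "(1 - \<theta>) * h x \<le> (1 - \<theta>)\<^sup>2 * h x + \<theta> * (1 - \<theta>) * (Q \<bullet> X)"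
  proof -
    have "\<theta> * (1 - \<theta>) * h x \<le> \<theta> * (1 - \<theta>) * (Q \<bullet> X)" using th iii by (intro mult_left_mono) auto
    then show ?thesis by (simp add: power2_eq_square algebra_simps)
  qed
  have 3: "(norm (x' - xs))\<^sup>2 = (1 - \<theta>)\<^sup>2 * (norm X)\<^sup>2 - 2 * (1 - \<theta>) * (X \<bullet> w) + (norm w)\<^sup>2"
  proof -
    have "x' - xs = (1 - \<theta>) *\<^sub>R X - w" by (simp add: x'_def step X_def algebra_simps)
    show ?thesis
      unfolding \<open>x' - xs = (1 - \<theta>) *\<^sub>R X - w\<close> power2_norm_eq_inner
      by (simp add: inner_diff_left inner_diff_right inner_commute power2_eq_square algebra_simps)
  qed
  have 4: "\<mu> * (X \<bullet> w) = \<theta> * (X \<bullet> Q) + k \<bullet> g x - Q \<bullet> k"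
    by (simp add: gx w_def \<theta>_def inner_simps inner_commute algebra_simps)
  have 5: "(Q + r) \<bullet> w = s * (norm Q)\<^sup>2 + Q \<bullet> k + r \<bullet> w"
    by (simp add: w_def inner_simps power2_norm_eq_inner algebra_simps)
  have "F x' - F xs = h x' + \<mu> / 2 * (norm (x' - xs))\<^sup>2" by (simp add: h_def)
  also have "\<dots> = h x' + (1 - \<theta>)\<^sup>2 * (\<mu> / 2 * (norm X)\<^sup>2) - (1 - \<theta>) * (\<mu> * (X \<bullet> w)) + \<mu> / 2 * (norm w)\<^sup>2"
    unfolding 3 by (simp add: algebra_simps)
  also have "\<dots> \<le> (1 - \<theta>)\<^sup>2 * h x + (1 - \<theta>)\<^sup>2 * (\<mu> / 2 * (norm X)\<^sup>2)
      - \<theta> * (Q \<bullet> k) - (1 - \<theta>) * (k \<bullet> g x) - s * (norm Q)\<^sup>2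
      + (- (r \<bullet> w) - (1 - \<theta>) * ((norm r)\<^sup>2 / (2 * (L - \<mu>)))) + \<mu> / 2 * (norm w)\<^sup>2"
    using 1 2 unfolding 4 5 by (simp add: inner_commute algebra_simps)
  also have "\<dots> \<le> (1 - \<theta>)\<^sup>2 * h x + (1 - \<theta>)\<^sup>2 * (\<mu> / 2 * (norm X)\<^sup>2)"
  proof -
    have "(L - \<mu>) * (norm w)\<^sup>2 + \<mu> / 2 * (norm w)\<^sup>2 = T * (norm w)\<^sup>2" by (simp add: T_def algebra_simps)
    then show ?thesis using rw kk final by linarith
  qed
  also have "\<dots> = (1 - \<theta>)\<^sup>2 * (F x - F xs)" by (simp add: h_def X_def algebra_simps)
  finally show ?thesis by (simp add: x'_def \<theta>_def s_def)
qed

text \<open>A gradient step of length \<open>1 / L\<close> from \<open>xs\<close> would lower the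
  value by \<open>(norm (g xs))\<^sup>2 / (2 * L)\<close>.\<close>

lemma sandwiched_minimizer_critical:
  assumes F: "sandwiched m L F g" and L: "0 < L" and min: "\<And>z. F xs \<le> F z"
  shows "g xs = 0"
proof -
  have "F xs \<le> F xs + g xs \<bullet> ((xs - (1 / L) *\<^sub>R g xs) - xs) + L / 2 * (norm ((xs - (1 / L) *\<^sub>R g xs) - xs))\<^sup>2"
    using min sandwichedD(2)[OF F] by (rule order_trans)
  also have "\<dots> = F xs - (norm (g xs))\<^sup>2 / (2 * L)"
    using L by (simp add: power_divide power2_norm_eq_inner[symmetric] field_simps power2_eq_square)
  finally have "(norm (g xs))\<^sup>2 / (2 * L) \<le> 0" by simp
  then show ?thesis using L by (simp add: divide_le_0_iff)
qed

text \<open>The distance to the minimizer measured by the objective gap: it equals the norm for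
  \<open>F z = L / 2 * (norm (z - xs))\<^sup>2\<close>.\<close>

definition gap_dist :: "real \<Rightarrow> ('a \<Rightarrow> real) \<Rightarrow> 'a \<Rightarrow> 'a \<Rightarrow> real" where
  "gap_dist L F xs z = sqrt (2 * (F z - F xs) / L)"

context
  fixes \<mu> L :: real and F :: "'a::real_inner \<Rightarrow> real" and g :: "'a \<Rightarrow> 'a" and xs :: 'a
  assumes F: "sandwiched \<mu> L F g" and mu: "0 < \<mu>" and L: "0 < L" and crit: "g xs = 0"
begin

lemma strongly_convex_growth: "\<mu> / 2 * (norm (z - xs))\<^sup>2 \<le> F z - F xs"
  using sandwichedD(1)[OF F, of xs z] crit by simp

lemma gap_nonneg: "0 \<le> F z - F xs"
  using strongly_convex_growth[of z] mu by (smt (verit) divide_nonneg_nonneg mult_nonneg_nonneg zero_le_power2)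

lemma gap_dist_power2: "(gap_dist L F xs z)\<^sup>2 = 2 * (F z - F xs) / L"
  unfolding gap_dist_def using gap_nonneg[of z] L by simp

lemma gap_dist_nonneg: "0 \<le> gap_dist L F xs z"
  unfolding gap_dist_def using gap_nonneg[of z] L by simp

lemma norm_le_gap_dist: "norm (z - xs) \<le> sqrt (L / \<mu>) * gap_dist L F xs z"
proof -
  have "\<mu> * (norm (z - xs))\<^sup>2 \<le> L * (gap_dist L F xs z)\<^sup>2"
    using strongly_convex_growth[of z] L by (simp add: gap_dist_power2)
  then have "(norm (z - xs))\<^sup>2 \<le> (sqrt (L / \<mu>) * gap_dist L F xs z)\<^sup>2"
    using mu L by (simp add: power_mult_distrib field_simps)
  then show ?thesis
    by (rule power2_le_imp_le) (use mu L in \<open>simp add: gap_dist_nonneg\<close>)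
qed

text \<open>Cocoercivity between \<open>z\<close> and the critical point \<open>xs\<close>. The
  normalization in \<open>gap_dist\<close> makes the constant the same \<open>L\<close> as for the
  Euclidean distance.\<close>

lemma norm_gradient_le_gap_dist: "norm (g z) \<le> L * gap_dist L F xs z"
proof -
  have "sandwiched 0 L F g"
    unfolding sandwiched_def
  proof (intro allI conjI)
    fix z z' :: 'a
    have "0 \<le> \<mu> / 2 * (norm (z' - z))\<^sup>2" using mu by simp
    then show "F z + g z \<bullet> (z' - z) + 0 / 2 * (norm (z' - z))\<^sup>2 \<le> F z'"
      using sandwichedD(1)[OF F, of z z'] by simp
  qed (rule sandwichedD(2)[OF F])
  from sandwiched_cocoercive[OF this L, of xs z]
  have "(norm (g z))\<^sup>2 / (2 * L) \<le> F z - F xs" by (simp add: crit)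
  then have "(norm (g z))\<^sup>2 \<le> 2 * L * (F z - F xs)" using L by (simp add: field_simps)
  also have "\<dots> = (L * gap_dist L F xs z)\<^sup>2"
    unfolding power_mult_distrib gap_dist_power2 using L by (simp add: power2_eq_square)
  finally show ?thesis by (rule power2_le_imp_le) (use L in \<open>simp add: gap_dist_nonneg\<close>)
qed

text \<open>Inserting the gradient bound into the smoothness inequality makes its right-hand side a
  perfect square.\<close>

lemma gap_dist_Lipschitz: "gap_dist L F xs (z + k) \<le> gap_dist L F xs z + norm k"
proof -
  have "F (z + k) \<le> F z + g z \<bullet> k + L / 2 * (norm k)\<^sup>2"
    using sandwichedD(2)[OF F, of "z + k" z] by simp
  also have "g z \<bullet> k \<le> L * gap_dist L F xs z * norm k"
    using norm_cauchy_schwarz[of "g z" k] mult_right_mono[OF norm_gradient_le_gap_dist, of "norm k" z]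
    by (meson norm_ge_zero order_trans)
  finally have *: "F (z + k) - F xs \<le> (F z - F xs) + L * gap_dist L F xs z * norm k + L / 2 * (norm k)\<^sup>2"
    by simp
  have "(gap_dist L F xs (z + k))\<^sup>2 \<le> 2 / L * ((F z - F xs) + L * gap_dist L F xs z * norm k + L / 2 * (norm k)\<^sup>2)"
    unfolding gap_dist_power2 using mult_left_mono[OF *, of "2 / L"] L by simp
  also have "\<dots> = (gap_dist L F xs z + norm k)\<^sup>2"
    using L by (simp add: power2_sum gap_dist_power2 field_simps)
  finally show ?thesis by (rule power2_le_imp_le) (simp add: gap_dist_nonneg)
qed

lemma gap_dist_preconditioned_step:
  assumes "\<mu> < L" and "0 \<le> (g x - \<mu> *\<^sub>R u) \<bullet> (L *\<^sub>R u - g x)" and "0 < a" "2 * a * L \<le> \<mu>"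
  shows "gap_dist L F xs (x - a *\<^sub>R u) \<le> (1 - a * \<mu> / L) * gap_dist L F xs x"
proof -
  have "a * \<mu> \<le> L"
  proof -
    have "2 * a * L \<le> 1 * L" using assms by linarith
    then have "a \<le> 1" using L by simp
    then have "a * \<mu> \<le> 1 * \<mu>" using mu by (intro mult_right_mono) auto
    then show ?thesis using assms by simp
  qed
  then have pos: "0 \<le> 1 - a * \<mu> / L" using L by simp
  have "(gap_dist L F xs (x - a *\<^sub>R u))\<^sup>2 \<le> 2 * ((1 - a * \<mu> / L)\<^sup>2 * (F x - F xs)) / L"
    unfolding gap_dist_power2
    using preconditioned_step_contracts[OF F mu assms(1) crit assms(2-4)] L
    by (intro divide_right_mono mult_left_mono) auto
  also have "\<dots> = ((1 - a * \<mu> / L) * gap_dist L F xs x)\<^sup>2"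
    by (simp add: power_mult_distrib gap_dist_power2)
  finally show ?thesis by (rule power2_le_imp_le) (intro mult_nonneg_nonneg pos gap_dist_nonneg)
qed

end

text \<open>Carries the sector condition from the single inverse Hessians to their average. The form
  is concave in \<open>u\<close>, with quadratic part \<open>- \<mu> * L * (norm u)\<^sup>2\<close>,
  so it lies below its tangent at the mean, and the linear terms sum to zero.\<close>

lemma sector_mean:
  fixes u :: "'n::finite \<Rightarrow> 'a::real_inner"
  assumes sec: "\<And>i. 0 \<le> (b - \<mu> *\<^sub>R u i) \<bullet> (L *\<^sub>R u i - b)" and "0 \<le> \<mu>" "0 \<le> L"
    and m: "m = (1 / real CARD('n)) *\<^sub>R (\<Sum>i\<in>UNIV. u i)"
  shows "0 \<le> (b - \<mu> *\<^sub>R m) \<bullet> (L *\<^sub>R m - b)"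
proof -
  have "(b - \<mu> *\<^sub>R u i) \<bullet> (L *\<^sub>R u i - b) \<le> (b - \<mu> *\<^sub>R m) \<bullet> (L *\<^sub>R m - b)
      + (L *\<^sub>R (b - \<mu> *\<^sub>R m) - \<mu> *\<^sub>R (L *\<^sub>R m - b)) \<bullet> (u i - m)" for i
  proof -
    have "0 \<le> \<mu> * L * ((u i - m) \<bullet> (u i - m))" using assms by simp
    then show ?thesis by (simp add: inner_simps inner_commute algebra_simps)
  qed
  note dev = order_trans[OF sec this]
  have "(\<Sum>i\<in>(UNIV::'n set). 0) \<le> (\<Sum>i\<in>UNIV. (b - \<mu> *\<^sub>R m) \<bullet> (L *\<^sub>R m - b)
      + (L *\<^sub>R (b - \<mu> *\<^sub>R m) - \<mu> *\<^sub>R (L *\<^sub>R m - b)) \<bullet> (u i - m))"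
    by (rule sum_mono) (rule dev)
  also have "\<dots> = real CARD('n) * ((b - \<mu> *\<^sub>R m) \<bullet> (L *\<^sub>R m - b))
      + (L *\<^sub>R (b - \<mu> *\<^sub>R m) - \<mu> *\<^sub>R (L *\<^sub>R m - b)) \<bullet> (\<Sum>i\<in>UNIV. u i - m)"
    by (simp add: sum.distrib inner_sum_right)
  also have "(\<Sum>i\<in>UNIV. u i - m) = 0"
    by (simp add: sum_subtractf m sum_constant_scaleR)
  finally show ?thesis by (simp add: zero_le_mult_iff)
qed

text \<open>By Cauchy-Schwarz, coercivity gives \<open>\<mu> * norm h \<le> norm (A *v h)\<close>;
  this makes the kernel trivial and bounds the inverse.\<close>

lemma coercive_matrix_inv:
  fixes A :: "real^'p^'p"
  assumes mu: "0 < \<mu>" and co: "\<And>h. \<mu> * (norm h)\<^sup>2 \<le> h \<bullet> (A *v h)"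
  shows "A *v (matrix_inv A *v b) = b" and "norm (matrix_inv A *v b) \<le> norm b / \<mu>"
proof -
  have lower: "\<mu> * norm h \<le> norm (A *v h)" for h
  proof (cases "h = 0")
    case False
    have "(\<mu> * norm h) * norm h \<le> norm (A *v h) * norm h"
      using co[of h] norm_cauchy_schwarz[of h "A *v h"] by (simp add: power2_eq_square mult_ac)
    then show ?thesis using False by simp
  qed simp
  have "h = 0" if "A *v h = 0" for h
    using lower[of h] that mu by (simp add: mult_le_0_iff)
  then have "invertible A"
    using invertible_left_inverse matrix_left_invertible_ker by blast
  then have "A ** matrix_inv A = Finite_Cartesian_Product.mat 1"
    unfolding invertible_def matrix_inv_def by (rule someI2_ex) blast
  then show inv: "A *v (matrix_inv A *v b) = b"
    by (metis matrix_vector_mul_assoc matrix_vector_mul_lid)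
  show "norm (matrix_inv A *v b) \<le> norm b / \<mu>"
    using lower[of "matrix_inv A *v b"] mu by (simp add: inv field_simps)
qed

section \<open>Frobenius norms and mixing\<close>

lemma frob_eq_norm: "frob X = norm (\<chi> i. X i)"
  by (simp add: frob_def norm_vec_def L2_set_def)

lemma frob_nonneg: "0 \<le> frob X"
  by (simp add: frob_eq_norm)

lemma frob_add_le: "frob (\<lambda>i. X i + Y i) \<le> frob X + frob Y"
proof -
  have "(\<chi> i. X i + Y i) = (\<chi> i. X i) + (\<chi> i. Y i)" by (simp add: Finite_Cartesian_Product.vec_eq_iff)
  then show ?thesis by (simp add: frob_eq_norm norm_triangle_ineq)
qed

lemma frob_scaleR: "frob (\<lambda>i. c *\<^sub>R X i) = \<bar>c\<bar> * frob X"
proof -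
  have "(\<chi> i. c *\<^sub>R X i) = c *\<^sub>R (\<chi> i. X i)" by (simp add: Finite_Cartesian_Product.vec_eq_iff)
  then show ?thesis by (simp add: frob_eq_norm)
qed

lemma frob_power2: "(frob X)\<^sup>2 = (\<Sum>i\<in>UNIV. (norm (X i))\<^sup>2)"
  by (simp add: frob_def sum_nonneg)

lemma frob_const: "frob (\<lambda>i::'n::finite. c) = sqrt (real CARD('n)) * norm c"
  by (simp add: frob_def real_sqrt_mult)

lemma frob_le_mult:
  assumes "\<And>i. norm (X i) \<le> c * norm (Y i)" and "0 \<le> c"
  shows "frob X \<le> c * frob Y"
proof -
  have "(frob X)\<^sup>2 \<le> (c * frob Y)\<^sup>2"
    unfolding frob_power2 power_mult_distrib sum_distrib_left
    using assms by (intro sum_mono) (metis norm_ge_zero power_mono power_mult_distrib)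
  then show ?thesis
    by (rule power2_le_imp_le) (simp add: assms(2) frob_nonneg)
qed

lemma frob_mean_le:
  fixes X :: "'n::finite \<Rightarrow> real^'p"
  shows "sqrt (real CARD('n)) * norm ((1 / real CARD('n)) *\<^sub>R (\<Sum>i\<in>UNIV. X i)) \<le> frob X"
proof -
  have N: "0 < real CARD('n)" by simp
  have "norm (\<Sum>i\<in>UNIV. X i) \<le> (\<Sum>i\<in>UNIV. norm (X i))" by (rule norm_sum)
  also have "\<dots> \<le> sqrt (real CARD('n)) * frob X"
    using L2_set_mult_ineq[of "\<lambda>_. 1" "\<lambda>i. norm (X i)" "UNIV :: 'n set"]
    by (simp add: L2_set_def frob_def)
  finally have "norm (\<Sum>i\<in>UNIV. X i) \<le> sqrt (real CARD('n)) * frob X" .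
  then have "sqrt (real CARD('n)) * norm (\<Sum>i\<in>UNIV. X i) \<le> sqrt (real CARD('n)) * (sqrt (real CARD('n)) * frob X)"
    by (intro mult_left_mono) auto
  also have "\<dots> = real CARD('n) * frob X" by (simp flip: mult.assoc)
  finally show ?thesis using N by (simp add: field_simps)
qed

text \<open>Centering is an orthogonal projection: by the variance identity it removes exactly the
  mass of the mean.\<close>

lemma frob_centered_le:
  fixes X :: "'n::finite \<Rightarrow> real^'p"
  shows "frob (\<lambda>i. X i - (1 / real CARD('n)) *\<^sub>R (\<Sum>j\<in>UNIV. X j)) \<le> frob X"
proof -
  define m where "m = (1 / real CARD('n)) *\<^sub>R (\<Sum>j\<in>UNIV. X j)"
  have sm: "(\<Sum>j\<in>UNIV. X j) = real CARD('n) *\<^sub>R m" by (simp add: m_def)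
  have "(\<Sum>i\<in>UNIV. (norm (X i - m))\<^sup>2) = (\<Sum>i\<in>UNIV. (norm (X i))\<^sup>2) - real CARD('n) * (norm m)\<^sup>2"
  proof -
    have "(norm (X i - m))\<^sup>2 = (norm (X i))\<^sup>2 - 2 * inner (X i) m + (norm m)\<^sup>2" for i
      by (simp add: power2_norm_eq_inner inner_diff_left inner_diff_right inner_commute)
    then have "(\<Sum>i\<in>UNIV. (norm (X i - m))\<^sup>2) = (\<Sum>i\<in>UNIV. (norm (X i))\<^sup>2) - 2 * inner (\<Sum>i\<in>UNIV. X i) m + real CARD('n) * (norm m)\<^sup>2"
      by (simp add: sum.distrib sum_subtractf inner_sum_left sum_distrib_left)
    then show ?thesis unfolding sm by (simp add: power2_norm_eq_inner)
  qed
  then have "(frob (\<lambda>i. X i - m))\<^sup>2 \<le> (frob X)\<^sup>2" unfolding frob_power2 by simp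
  then show ?thesis unfolding m_def[symmetric] by (rule power2_le_imp_le[OF _ frob_nonneg])
qed

lemma spec_norm_nonneg: "0 \<le> spec_norm M"
  unfolding spec_norm_def by (intro onorm_pos_le) (simp add: linear_linear)

text \<open>The squared Frobenius norm is also the sum over the columns of the stacked matrix, and
  \<open>M\<close> acts on each column separately.\<close>

lemma frob_matrix_action_le:
  fixes M :: "real^'n^'n" and X :: "'n::finite \<Rightarrow> real^'p"
  shows "frob (\<lambda>i. \<Sum>j\<in>UNIV. M $ i $ j *\<^sub>R X j) \<le> spec_norm M * frob X"
proof -
  have swap: "(frob Z)\<^sup>2 = (\<Sum>c\<in>UNIV. (norm (\<chi> i. Z i $ c))\<^sup>2)" for Z :: "'n \<Rightarrow> real^'p"
    unfolding frob_power2 norm_vec_def L2_set_def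
    by (simp add: sum_nonneg) (rule sum.swap)
  have act: "(\<chi> i. (\<Sum>j\<in>UNIV. M $ i $ j *\<^sub>R X j) $ c) = M *v (\<chi> i. X i $ c)" for c
    by (simp add: Finite_Cartesian_Product.vec_eq_iff matrix_vector_mult_def)
  have "(frob (\<lambda>i. \<Sum>j\<in>UNIV. M $ i $ j *\<^sub>R X j))\<^sup>2 \<le> (spec_norm M * frob X)\<^sup>2"
    unfolding power_mult_distrib swap act sum_distrib_left
  proof (rule sum_mono)
    fix c
    have "norm (M *v (\<chi> i. X i $ c)) \<le> spec_norm M * norm (\<chi> i. X i $ c)"
      unfolding spec_norm_def by (rule onorm) (simp add: linear_linear)
    then show "(norm (M *v (\<chi> i. X i $ c)))\<^sup>2 \<le> (spec_norm M)\<^sup>2 * (norm (\<chi> i. X i $ c))\<^sup>2"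
      by (metis norm_ge_zero power_mono power_mult_distrib)
  qed
  then show ?thesis
    by (rule power2_le_imp_le) (simp add: spec_norm_nonneg frob_nonneg)
qed

lemma sum_mixing:
  fixes W :: "real^'n^'n" and z :: "'n::finite \<Rightarrow> 'a::real_vector"
  assumes "\<And>j. (\<Sum>i\<in>UNIV. W $ i $ j) = 1"
  shows "(\<Sum>i\<in>UNIV. \<Sum>j\<in>UNIV. W $ i $ j *\<^sub>R z j) = (\<Sum>j\<in>UNIV. z j)"
  by (subst sum.swap) (simp add: scaleR_left.sum[symmetric] assms)

text \<open>Expresses mixing through deviations from the mean, so that the spectral norms
  \<open>sig\<close> and \<open>vsig\<close> apply. Deviations sum to zero, hence the averaging
  matrix kills them; unit row sums make \<open>W\<close> fix the mean.\<close>

lemma mixing_deviation: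
  fixes W :: "real^'n^'n" and z :: "'n::finite \<Rightarrow> 'a::real_vector"
  assumes rows: "\<And>i. (\<Sum>j\<in>UNIV. W $ i $ j) = 1"
    and m: "m = (1 / real CARD('n)) *\<^sub>R (\<Sum>j\<in>UNIV. z j)"
  shows "(\<Sum>j\<in>UNIV. (W - (\<chi> i j. 1 / real CARD('n))) $ i $ j *\<^sub>R (z j - m)) = (\<Sum>j\<in>UNIV. W $ i $ j *\<^sub>R z j) - m"
    and "(\<Sum>j\<in>UNIV. (W - (\<chi> i j. if i = j then 1 else 0)) $ i $ j *\<^sub>R (z j - m)) = (\<Sum>j\<in>UNIV. W $ i $ j *\<^sub>R z j) - z i"
proof -
  have 0: "(\<Sum>j\<in>UNIV. z j - m) = 0"
    by (simp add: sum_subtractf m sum_constant_scaleR)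
  have W: "(\<Sum>j\<in>UNIV. W $ i $ j *\<^sub>R (z j - m)) = (\<Sum>j\<in>UNIV. W $ i $ j *\<^sub>R z j) - m"
    by (simp add: scaleR_diff_right sum_subtractf scaleR_left.sum[symmetric] rows)
  show "(\<Sum>j\<in>UNIV. (W - (\<chi> i j. 1 / real CARD('n))) $ i $ j *\<^sub>R (z j - m)) = (\<Sum>j\<in>UNIV. W $ i $ j *\<^sub>R z j) - m"
    using W 0 by (simp add: scaleR_diff_left sum_subtractf scaleR_right.sum[symmetric])
  have "(\<Sum>j\<in>UNIV. (if i = j then 1 else (0::real)) *\<^sub>R (z j - m)) = (\<Sum>j\<in>UNIV. if i = j then z j - m else 0)"
    by (intro sum.cong) auto
  then show "(\<Sum>j\<in>UNIV. (W - (\<chi> i j. if i = j then 1 else 0)) $ i $ j *\<^sub>R (z j - m)) = (\<Sum>j\<in>UNIV. W $ i $ j *\<^sub>R z j) - z i"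
    using W by (simp add: scaleR_diff_left sum_subtractf)
qed

section \<open>Positive matrices\<close>

text \<open>The map \<open>M v / s v\<close> sends the standard simplex \<open>S\<close> to itself,
  because positivity of \<open>M\<close> keeps the entry sum \<open>s v\<close> away from zero. A
  fixed point is an eigenvector, and being in the image of the map it is entrywise positive.\<close>

lemma positive_matrix_has_positive_eigenvector:
  fixes M :: "real^'n^'n"
  assumes pos: "\<And>i j. 0 < M $ i $ j"
  obtains r w where "0 < r" "\<And>i. 0 < w $ i" "M *v w = r *\<^sub>R w"
proof -
  define S where "S = {v::real^'n. (\<forall>i. 0 \<le> v $ i) \<and> (\<Sum>i\<in>UNIV. v $ i) = 1}"
  define s where "s = (\<lambda>v. \<Sum>i\<in>UNIV. (M *v v) $ i)"
  have Mv: "0 < (M *v v) $ i" if v: "v \<in> S" for v i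
  proof -
    have "\<exists>j. v $ j \<noteq> 0"
    proof (rule ccontr)
      assume "\<not> (\<exists>j. v $ j \<noteq> 0)"
      then have "(\<Sum>j\<in>UNIV. v $ j) = 0" by simp
      then show False using v by (simp add: S_def)
    qed
    then obtain j where "v $ j \<noteq> 0" ..
    then have "0 < v $ j" using v by (auto simp: S_def less_le)
    then have "0 < M $ i $ j * v $ j" using pos by simp
    also have "\<dots> \<le> (\<Sum>j\<in>UNIV. M $ i $ j * v $ j)"
      using v pos by (intro member_le_sum) (auto simp: S_def less_imp_le)
    finally show ?thesis by (simp add: matrix_vector_mult_def)
  qed
  have s: "0 < s v" if "v \<in> S" for v
    unfolding s_def using Mv[OF that] by (intro sum_pos) auto
  have "bounded S"
  proof (rule boundedI)
    fix v assume v: "v \<in> S"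
    have "norm v \<le> (\<Sum>i\<in>UNIV. \<bar>v $ i\<bar>)" by (rule norm_le_l1_cart)
    also have "\<dots> = 1" using v by (simp add: S_def)
    finally show "norm v \<le> 1" .
  qed
  moreover have "closed S"
    unfolding S_def by (intro closed_Collect_conj closed_Collect_all closed_Collect_le closed_Collect_eq continuous_intros)
  ultimately have "compact S" by (simp add: compact_eq_bounded_closed)
  moreover have "convex S"
    unfolding convex_def S_def by (auto simp: sum.distrib sum_distrib_left[symmetric])
  moreover have "(\<chi> i. 1 / real CARD('n)) \<in> S" by (simp add: S_def)
  then have "S \<noteq> {}" by blast
  moreover have "continuous_on S (\<lambda>v. (1 / s v) *\<^sub>R (M *v v))"
  proof -
    have "continuous_on S ((*v) M)" by (intro linear_continuous_on) (simp add: linear_linear)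
    then show ?thesis
      unfolding s_def using s by (intro continuous_intros) (auto simp: s_def less_le)
  qed
  moreover have "(\<lambda>v. (1 / s v) *\<^sub>R (M *v v)) \<in> S \<rightarrow> S"
  proof
    fix v assume v: "v \<in> S"
    have "(\<Sum>i\<in>UNIV. ((1 / s v) *\<^sub>R (M *v v)) $ i) = 1"
      using s[OF v] by (simp add: sum_divide_distrib[symmetric]) (simp add: s_def)
    then show "(1 / s v) *\<^sub>R (M *v v) \<in> S"
      using Mv[OF v] s[OF v] by (simp add: S_def less_imp_le)
  qed
  ultimately obtain w where w: "w \<in> S" "(1 / s w) *\<^sub>R (M *v w) = w"
    using brouwer by blast
  have "M *v w = s w *\<^sub>R w"
    using arg_cong[OF w(2), of "\<lambda>v. s w *\<^sub>R v"] s[OF w(1)] by simp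
  moreover have "0 < w $ i" for i
  proof -
    have "w $ i = (1 / s w) * (M *v w) $ i" by (subst w(2)[symmetric]) simp
    then show ?thesis using Mv[OF w(1)] s[OF w(1)] by simp
  qed
  ultimately show ?thesis using that s[OF w(1)] by blast
qed

text \<open>The positive vector makes \<open>r\<close> an eigenvalue. Conversely, for any complex
  eigenvector \<open>v\<close>, taking absolute values in the row where
  \<open>norm (v i) / w i\<close> is largest bounds its eigenvalue by \<open>r\<close>.\<close>

lemma real_spectral_radius_eqI:
  fixes A :: "real Matrix.mat" and w :: "nat \<Rightarrow> real"
  assumes A: "A \<in> carrier_mat n n" and n: "0 < n"
    and nonneg: "\<And>i j. i < n \<Longrightarrow> j < n \<Longrightarrow> 0 \<le> A $$ (i, j)"
    and w: "\<And>i. i < n \<Longrightarrow> 0 < w i"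
    and eig: "\<And>i. i < n \<Longrightarrow> (\<Sum>j<n. A $$ (i, j) * w j) = r * w i"
    and r: "0 \<le> r"
  shows "real_spectral_radius A = r"
proof -
  let ?A = "map_mat complex_of_real A"
  have cA: "?A \<in> carrier_mat n n" using A by simp
  have mv: "vec_index (?A *\<^sub>v v) i = (\<Sum>j<n. complex_of_real (A $$ (i, j)) * vec_index v j)"
    if "v \<in> carrier_vec n" "i < n" for v i
    using that A by (auto simp: scalar_prod_def atLeast0LessThan intro!: sum.cong)
  define cw where "cw = Matrix.vec n (\<lambda>i. complex_of_real (w i))"
  have "eigenvector ?A cw (complex_of_real r)"
    unfolding eigenvector_def
  proof (intro conjI)
    show "cw \<in> carrier_vec (dim_row ?A)" using A by (simp add: cw_def)
    have "vec_index cw 0 \<noteq> vec_index (0\<^sub>v n) 0" using n w[OF n] by (simp add: cw_def)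
    then show "cw \<noteq> 0\<^sub>v (dim_row ?A)" using A by auto
    show "?A *\<^sub>v cw = complex_of_real r \<cdot>\<^sub>v cw"
    proof (rule eq_vecI)
      fix i assume "i < dim_vec (complex_of_real r \<cdot>\<^sub>v cw)"
      then have i: "i < n" by (simp add: cw_def)
      have "vec_index (?A *\<^sub>v cw) i = complex_of_real (\<Sum>j<n. A $$ (i, j) * w j)"
        using i by (subst mv) (auto simp: cw_def)
      then show "vec_index (?A *\<^sub>v cw) i = vec_index (complex_of_real r \<cdot>\<^sub>v cw) i"
        using i by (simp add: eig cw_def)
    qed (use A in \<open>simp add: cw_def\<close>)
  qed
  then have "norm (complex_of_real r) \<in> norm ` spectrum ?A"
    unfolding spectrum_def eigenvalue_def by blast
  then have ge: "r \<le> spectral_radius ?A"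
    using spectral_radius_mem_max(2)[OF cA n] r by simp
  obtain ev where ev: "ev \<in> spectrum ?A" "spectral_radius ?A = norm ev"
    using spectral_radius_mem_max(1)[OF cA n] by auto
  then obtain v where v: "v \<in> carrier_vec n" "v \<noteq> 0\<^sub>v n" "?A *\<^sub>v v = ev \<cdot>\<^sub>v v"
    using A unfolding spectrum_def eigenvalue_def eigenvector_def by auto
  define c where "c = Max ((\<lambda>i. norm (vec_index v i) / w i) ` {..<n})"
  have c_ge: "norm (vec_index v i) \<le> c * w i" if "i < n" for i
  proof -
    have "norm (vec_index v i) / w i \<le> c" unfolding c_def using that by (intro Max_ge) auto
    then show ?thesis using w[OF that] by (simp add: pos_divide_le_eq)
  qed
  have "c \<in> (\<lambda>i. norm (vec_index v i) / w i) ` {..<n}"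
    unfolding c_def using n by (intro Max_in) auto
  then obtain i where i: "i < n" "c = norm (vec_index v i) / w i" by auto
  have cw_i: "norm (vec_index v i) = c * w i" using i w[OF i(1)] by simp
  have "0 < c"
  proof (rule ccontr)
    assume "\<not> 0 < c"
    have "vec_index v j = 0" if "j < n" for j
    proof -
      have "c * w j \<le> 0" using \<open>\<not> 0 < c\<close> w[OF that] by (intro mult_nonpos_nonneg) auto
      then have "norm (vec_index v j) \<le> 0" using c_ge[OF that] by linarith
      then show ?thesis by simp
    qed
    then show False using v(1,2) by auto
  qed
  have "norm ev * norm (vec_index v i) = norm (vec_index (?A *\<^sub>v v) i)"
    using v i by (simp add: norm_mult)
  also have "\<dots> \<le> (\<Sum>j<n. norm (complex_of_real (A $$ (i, j)) * vec_index v j))"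
    using v(1) i by (subst mv) (auto intro: norm_sum)
  also have "\<dots> \<le> (\<Sum>j<n. A $$ (i, j) * (c * w j))"
    using i(1) c_ge nonneg by (intro sum_mono) (auto simp: norm_mult intro!: mult_left_mono)
  also have "\<dots> = c * (r * w i)"
    by (simp add: eig[OF i(1), symmetric] sum_distrib_left mult_ac)
  finally have "norm ev * (c * w i) \<le> r * (c * w i)" by (simp add: cw_i mult_ac)
  then have "norm ev \<le> r" using \<open>0 < c\<close> w[OF i(1)] by simp
  then show ?thesis using ge ev unfolding real_spectral_radius_def by simp
qed

text \<open>Take the least \<open>c\<close> with \<open>w \<le> c b\<close> entrywise. In a row
  where equality holds, \<open>r w = M w \<le> c M b < c b = w\<close>.\<close>

lemma eigenvalue_less_one_if_strictly_subinvariant: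
  fixes M :: "real^'n^'n"
  assumes nonneg: "\<And>i j. 0 \<le> M $ i $ j" and w: "\<And>i. 0 < w $ i" and eig: "M *v w = r *\<^sub>R w"
    and b: "\<And>i. 0 < b $ i" and sub: "\<And>i. (M *v b) $ i < b $ i"
  shows "r < 1"
proof -
  define c where "c = Max (range (\<lambda>i. w $ i / b $ i))"
  have c_ge: "w $ i \<le> c * b $ i" for i
  proof -
    have "w $ i / b $ i \<le> c" unfolding c_def by (intro Max_ge) auto
    then show ?thesis using b[of i] by (simp add: pos_divide_le_eq)
  qed
  have "c \<in> range (\<lambda>i. w $ i / b $ i)" unfolding c_def by (intro Max_in) auto
  then obtain i where i: "c = w $ i / b $ i" by auto
  have c: "0 < c" "w $ i = c * b $ i" using i w[of i] b[of i] by simp_all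
  have "r * w $ i = (\<Sum>j\<in>UNIV. M $ i $ j * w $ j)"
    using arg_cong[OF eig, of "\<lambda>v. v $ i"] by (simp add: matrix_vector_mult_def)
  also have "\<dots> \<le> (\<Sum>j\<in>UNIV. M $ i $ j * (c * b $ j))"
    using c_ge nonneg by (intro sum_mono mult_left_mono)
  also have "\<dots> = c * (M *v b) $ i" by (simp add: matrix_vector_mult_def sum_distrib_left mult_ac)
  also have "\<dots> < c * b $ i" using c sub by simp
  finally have "r * w $ i < 1 * w $ i" by (simp add: c(2))
  then show ?thesis using w[of i] by (simp only: mult_less_cancel_right_pos)
qed

text \<open>A nonnegative matrix preserves the entrywise order, so a domination by a multiple of
  \<open>w\<close> at time 0 propagates with one factor \<open>r\<close> per step.\<close>

lemma geometric_decay: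
  fixes M :: "real^'n^'n"
  assumes nonneg: "\<And>i j. 0 \<le> M $ i $ j" and w: "\<And>i. 0 < w $ i" and eig: "M *v w = r *\<^sub>R w"
    and step: "\<And>t i. z (Suc t) $ i \<le> (M *v z t) $ i"
  shows "\<exists>c. \<forall>t i. z t $ i \<le> c * r ^ t * w $ i"
proof -
  define c where "c = Max (range (\<lambda>i. z 0 $ i / w $ i))"
  have "z t $ i \<le> c * r ^ t * w $ i" for t i
  proof (induction t arbitrary: i)
    case 0
    have "z 0 $ i / w $ i \<le> c" unfolding c_def by (intro Max_ge) auto
    then show ?case using w[of i] by (simp add: pos_divide_le_eq)
  next
    case (Suc t)
    have "z (Suc t) $ i \<le> (\<Sum>j\<in>UNIV. M $ i $ j * z t $ j)"
      using step[of t i] by (simp add: matrix_vector_mult_def)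
    also have "\<dots> \<le> (\<Sum>j\<in>UNIV. M $ i $ j * (c * r ^ t * w $ j))"
      using Suc nonneg by (intro sum_mono mult_left_mono)
    also have "\<dots> = c * r ^ t * (M *v w) $ i"
      by (simp add: matrix_vector_mult_def sum_distrib_left mult_ac)
    also have "\<dots> = c * r ^ Suc t * w $ i" by (simp add: eig mult_ac)
    finally show ?case .
  qed
  then show ?thesis by blast
qed

lemma vector_4:
  "(vector [a, b, c, d] :: 'a::zero^4) $ 1 = a"
  "(vector [a, b, c, d] :: 'a::zero^4) $ 2 = b"
  "(vector [a, b, c, d] :: 'a::zero^4) $ 3 = c"
  "(vector [a, b, c, d] :: 'a::zero^4) $ 4 = d"
  by (simp_all add: vector_def)

section \<open>Convergence\<close>

text \<open>Links the two matrix encodings: vectors over the index type 4 count from 1, the matrix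
  \<open>A_mat\<close> counts from 0, and the list \<open>?w\<close> realigns the
  eigenvector.\<close>

lemma A_mat_spectral_radius:
  fixes sig vsig L mu kap alpha beta :: real
  defines "M \<equiv> vector [vector [sig + alpha * kap, alpha / mu, alpha * kap, beta],
      vector [L * (vsig + alpha * kap), sig + alpha * kap, L * alpha * kap, L * beta],
      vector [alpha * kap, alpha / mu, 1 - alpha / kap, beta],
      vector [vsig + alpha * kap, alpha / mu, alpha * kap, beta]] :: real^4^4"
  assumes nonneg: "\<And>i j. 0 \<le> M $ i $ j" and w: "\<And>i. 0 < w $ i"
    and eig: "M *v w = r *\<^sub>R w" and r: "0 \<le> r"
  shows "real_spectral_radius (A_mat sig vsig L mu kap alpha beta) = r"
proof (rule real_spectral_radius_eqI)
  let ?A = "A_mat sig vsig L mu kap alpha beta"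
  let ?w = "\<lambda>i. [w $ 1, w $ 2, w $ 3, w $ 4] ! i"
  have less_4: "i < 4 \<longleftrightarrow> i = 0 \<or> i = 1 \<or> i = 2 \<or> i = 3" for i :: nat by auto
  have sum4: "(\<Sum>j<4. h j) = h 0 + h 1 + h 2 + h 3" for h :: "nat \<Rightarrow> real"
    by (simp add: numeral_eq_Suc)
  show "?A \<in> carrier_mat 4 4" unfolding A_mat_def mat_of_rows_list_def by (rule carrier_matI) simp_all
  show "0 < (4::nat)" by simp
  have n: "\<forall>i j. 0 \<le> M $ i $ j" using nonneg by blast
  show "0 \<le> ?A $$ (i, j)" if "i < 4" "j < 4" for i j
    using that n unfolding less_4 forall_4 M_def
    by (auto simp: A_mat_def mat_of_rows_list_def vector_4)
  show "0 < ?w i" if "i < 4" for i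
    using that w unfolding less_4 by auto
  have "\<forall>i. (\<Sum>j\<in>UNIV. M $ i $ j * w $ j) = r * w $ i"
    using eig by (simp add: Finite_Cartesian_Product.vec_eq_iff matrix_vector_mult_def)
  then show "(\<Sum>j<4. ?A $$ (i, j) * ?w j) = r * ?w i" if "i < 4" for i
    using that unfolding less_4 sum4 forall_4 sum_4 M_def
    by (auto simp: A_mat_def mat_of_rows_list_def vector_4)
  show "0 \<le> r" by (rule r)
qed

theorem theorem1:
  fixes f :: "'n::finite \<Rightarrow> real^'p \<Rightarrow> real"
    and G :: "'n \<Rightarrow> real^'p \<Rightarrow> real^'p"
    and H :: "'n \<Rightarrow> real^'p \<Rightarrow> real^'p^'p"
    and mu L :: real
    and xstar :: "real^'p"
    and W :: "real^'n^'n"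
    and eps1 eps2 eps3 eps4 alpha beta :: real
    and x y v :: "nat \<Rightarrow> 'n \<Rightarrow> real^'p"
  defines "N \<equiv> real CARD('n)"
  defines "kappa \<equiv> L / mu"
  defines "vsig \<equiv> spec_norm (W - (\<chi> i j. if i = j then 1 else 0))"
  defines "sig \<equiv> spec_norm (W - (\<chi> i j. 1 / N))"
  defines "sigbar \<equiv> 1 - sig"
  defines "epst \<equiv> kappa * (eps1 + eps3) + eps2 / mu"
  defines "epsb \<equiv> L * kappa * (eps1 + eps3) + kappa * eps2"
  defines "d \<equiv> (\<lambda>t i. matrix_inv (H i (x t i)) *v y t i)"
  defines "xbar \<equiv> (\<lambda>t. (1 / N) *\<^sub>R (\<Sum>i\<in>UNIV. x t i))"
  defines "ybar \<equiv> (\<lambda>t. (1 / N) *\<^sub>R (\<Sum>i\<in>UNIV. y t i))"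
  defines "e1 \<equiv> (\<lambda>t. frob (\<lambda>i. x t i - xbar t))"
  defines "e2 \<equiv> (\<lambda>t. frob (\<lambda>i. y t i - ybar t))"
  defines "e3 \<equiv> (\<lambda>t. sqrt N * norm (xbar t - xstar))"
  defines "e4 \<equiv> (\<lambda>t. if t = 0 then 0 else frob (\<lambda>i. x t i - x (t - 1) i))"
  defines "rho \<equiv> real_spectral_radius (A_mat sig vsig L mu kappa alpha beta)"
  assumes N2: "CARD('n) \<ge> 2"
    and muL: "0 < mu" "mu < L"
    and grad: "\<And>i z. (f i has_derivative (\<lambda>h. G i z \<bullet> h)) (at z)"
    and hess: "\<And>i z. (G i has_derivative (\<lambda>h. H i z *v h)) (at z)"
    and hess_bounds: "\<And>i z h. mu * (norm h)\<^sup>2 \<le> h \<bullet> (H i z *v h)"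
                     "\<And>i z h. h \<bullet> (H i z *v h) \<le> L * (norm h)\<^sup>2"
    and lipschitz: "\<And>i z z'. norm (G i z - G i z') \<le> L * norm (z - z')"
    and minimizer: "\<And>z. (1 / N) * (\<Sum>i\<in>UNIV. f i xstar) \<le> (1 / N) * (\<Sum>i\<in>UNIV. f i z)"
    and W_nonneg: "\<And>i j. 0 \<le> W $ i $ j"
    and W_rows: "\<And>i. (\<Sum>j\<in>UNIV. W $ i $ j) = 1"
    and W_cols: "\<And>j. (\<Sum>i\<in>UNIV. W $ i $ j) = 1"
    and W_diag: "\<And>i. 0 < W $ i $ i"
    and sig_lt1: "sig < 1"
    and eps_pos: "0 < eps1" "0 < eps2" "0 < eps3" "0 < eps4"
    and eps1_bd: "eps1 < min (sigbar * eps2 / (L * vsig))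
                      (min (eps3 / kappa\<^sup>2 - eps2 / (mu * kappa)) (eps4 / vsig))"
    and alpha_bd: "0 < alpha"
      "alpha < min (1 / kappa) (min (sigbar * eps1 / epst)
                 (min ((sigbar * eps2 - L * vsig * eps1) / epsb) ((eps4 - vsig * eps1) / epst)))"
    and beta_bd: "0 < beta"
      "beta < min (epst / eps4 * (sigbar * eps1 / epst - alpha))
               (min (epsb / (L * eps4) * ((sigbar * eps2 - L * vsig * eps1) / epsb - alpha))
               (min (alpha / eps4 * (eps3 / kappa - kappa * eps1 - eps2 / mu))
                    (epst / eps4 * ((eps4 - vsig * eps1) / epst - alpha))))"
    and x_rec: "\<And>t i. x (Suc t) i = (\<Sum>j\<in>UNIV. W $ i $ j *\<^sub>R x t j) - alpha *\<^sub>R d t i + beta *\<^sub>R v t i"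
    and y_rec: "\<And>t i. y (Suc t) i = (\<Sum>j\<in>UNIV. W $ i $ j *\<^sub>R y t j) + (G i (x (Suc t) i) - G i (x t i))"
    and v_rec: "\<And>t i. v (Suc t) i = x (Suc t) i - x t i"
    and y_init: "\<And>i. y 0 i = G i (x 0 i)"
    and v_init: "\<And>i. v 0 i = 0"
  shows "rho < 1 \<and>
         (\<lambda>t. vector [e1 t, e2 t, e3 t, e4 t] :: real^4) \<longlonglongrightarrow> 0 \<and>
         (\<exists>C. \<forall>t. norm (vector [e1 t, e2 t, e3 t, e4 t] :: real^4) \<le> C * rho ^ t)"
proof -
  define F where "F = (\<lambda>z. 1 / N * (\<Sum>i\<in>UNIV. f i z))"
  define g where "g = (\<lambda>z. (1 / N) *\<^sub>R (\<Sum>i\<in>UNIV. G i z))"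
  define M where "M = (vector [vector [sig + alpha * kappa, alpha / mu, alpha * kappa, beta],
      vector [L * (vsig + alpha * kappa), sig + alpha * kappa, L * alpha * kappa, L * beta],
      vector [alpha * kappa, alpha / mu, 1 - alpha / kappa, beta],
      vector [vsig + alpha * kappa, alpha / mu, alpha * kappa, beta]] :: real^4^4)"
  have N: "0 < N" by (simp add: N_def)
  have L: "0 < L" using muL by linarith
  have kappa: "1 < kappa" using muL by (simp add: kappa_def)
  have sig0: "0 \<le> sig" and vsig0: "0 \<le> vsig"
    unfolding sig_def vsig_def by (rule spec_norm_nonneg)+
  have epst: "0 < epst" and epsb: "0 < epsb"
    unfolding epst_def epsb_def using eps_pos kappa muL L by (simp_all add: add_pos_pos)

  \<comment> \<open>Consequences of the parameter bounds\<close>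
  have alpha_kappa: "alpha * kappa < 1"
    using alpha_bd kappa by (simp add: field_simps)
  \<comment> \<open>With the denominators cleared, the four bounds on \<open>beta\<close> in
    \<open>a1\<close> to \<open>a4\<close> become the four rows of the inequality
    \<open>M \<epsilon> < \<epsilon>\<close>.\<close>
  have a1: "alpha * epst + beta * eps4 < sigbar * eps1"
  proof -
    have "beta < epst / eps4 * (sigbar * eps1 / epst - alpha)" using beta_bd by simp
    also have "\<dots> = (sigbar * eps1 - alpha * epst) / eps4" using epst eps_pos by (simp add: field_simps)
    finally show ?thesis using eps_pos by (simp add: field_simps)
  qed
  have a2: "alpha * epsb + L * beta * eps4 < sigbar * eps2 - L * vsig * eps1"
  proof -
    have "beta < epsb / (L * eps4) * ((sigbar * eps2 - L * vsig * eps1) / epsb - alpha)" using beta_bd by simp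
    also have "\<dots> = (sigbar * eps2 - L * vsig * eps1 - alpha * epsb) / (L * eps4)"
      using epsb eps_pos L by (simp add: field_simps)
    finally show ?thesis using eps_pos L by (simp add: field_simps)
  qed
  have a3: "beta * eps4 < alpha * (eps3 / kappa - kappa * eps1 - eps2 / mu)"
  proof -
    have "beta < alpha / eps4 * (eps3 / kappa - kappa * eps1 - eps2 / mu)" using beta_bd by simp
    also have "\<dots> = alpha * (eps3 / kappa - kappa * eps1 - eps2 / mu) / eps4" by simp
    finally show ?thesis using eps_pos by (simp only: pos_less_divide_eq)
  qed
  have a4: "alpha * epst + beta * eps4 < eps4 - vsig * eps1"
  proof -
    have "beta < epst / eps4 * ((eps4 - vsig * eps1) / epst - alpha)" using beta_bd by simp
    also have "\<dots> = (eps4 - vsig * eps1 - alpha * epst) / eps4" using epst eps_pos by (simp add: field_simps)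
    finally show ?thesis using eps_pos by (simp add: field_simps)
  qed

  \<comment> \<open>The comparison matrix and its Perron eigenvalue\<close>
  have Mpos: "0 < M $ i $ j" for i j
  proof -
    \<comment> \<open>Needed for the only entry with a negative term,
      \<open>1 - alpha / kappa\<close>.\<close>
    have "alpha / kappa < 1"
    proof -
      have "alpha * 1 \<le> alpha * kappa" using alpha_bd(1) kappa by (intro mult_left_mono) auto
      then show ?thesis using alpha_kappa kappa by simp
    qed
    moreover have "0 < alpha * kappa" "0 < alpha / mu" using alpha_bd(1) kappa muL by auto
    ultimately have "\<forall>i j. 0 < M $ i $ j"
      unfolding forall_4 M_def vector_4 using sig0 vsig0 beta_bd(1) L
      by (auto simp: mult.assoc intro!: mult_pos_pos add_nonneg_pos)
    then show ?thesis by blast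
  qed
  obtain r w where r: "0 < r" and w: "\<And>i. 0 < w $ i" and eig: "M *v w = r *\<^sub>R w"
    using positive_matrix_has_positive_eigenvector[of M, OF Mpos] by blast
  have rho: "rho = r"
    unfolding rho_def using Mpos w eig r unfolding M_def
    by (intro A_mat_spectral_radius[where w = w]) (auto intro: less_imp_le)
  have r1: "r < 1"
  proof (rule eigenvalue_less_one_if_strictly_subinvariant[OF less_imp_le[OF Mpos] w eig])
    let ?b = "vector [eps1, eps2, eps3, eps4] :: real^4"
    have "\<forall>i. 0 < ?b $ i" unfolding forall_4 vector_4 using eps_pos by simp
    then show "0 < ?b $ i" for i by blast
    have "\<forall>i. (M *v ?b) $ i < ?b $ i"
      unfolding forall_4 matrix_vector_mult_def vec_lambda_beta sum_4 M_def vector_4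
    proof (intro conjI)
      show "(sig + alpha * kappa) * eps1 + alpha / mu * eps2 + alpha * kappa * eps3 + beta * eps4 < eps1"
        using a1 unfolding epst_def sigbar_def by (simp add: algebra_simps)
      have "L * (alpha * eps2 / mu) = alpha * kappa * eps2" by (simp add: kappa_def)
      then show "L * (vsig + alpha * kappa) * eps1 + (sig + alpha * kappa) * eps2 + L * alpha * kappa * eps3 + L * beta * eps4 < eps2"
        using a2 unfolding epsb_def sigbar_def by (simp add: algebra_simps)
      show "alpha * kappa * eps1 + alpha / mu * eps2 + (1 - alpha / kappa) * eps3 + beta * eps4 < eps3"
        using a3 by (simp add: algebra_simps)
      show "(vsig + alpha * kappa) * eps1 + alpha / mu * eps2 + alpha * kappa * eps3 + beta * eps4 < eps4"
        using a4 unfolding epst_def by (simp add: algebra_simps)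
    qed
    then show "(M *v ?b) $ i < ?b $ i" for i by blast
  qed

  \<comment> \<open>The step bound of the contraction lemma. The bound on \<open>eps1\<close> yields
    \<open>eps1 \<le> eps3\<close>, so \<open>epst\<close> is at least
    \<open>2 * kappa * eps1\<close>, whereas \<open>a1\<close> gives
    \<open>alpha * epst < eps1\<close>.\<close>
  have small: "2 * alpha * L \<le> mu"
  proof -
    have "eps1 < eps3 / kappa\<^sup>2 - eps2 / (mu * kappa)" using eps1_bd by simp
    moreover have "0 < eps2 / (mu * kappa)" using eps_pos muL kappa by simp
    ultimately have "eps1 < eps3 / kappa\<^sup>2" by linarith
    moreover have "eps3 / kappa\<^sup>2 \<le> eps3 / 1"
      using eps_pos kappa by (intro divide_left_mono) (auto simp: one_le_power)
    ultimately have "eps1 \<le> eps3" by simp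
    then have "kappa * (2 * eps1) \<le> kappa * (eps1 + eps3)" using kappa by (intro mult_left_mono) auto
    also have "\<dots> \<le> epst" unfolding epst_def using eps_pos muL by simp
    finally have "alpha * (kappa * (2 * eps1)) \<le> alpha * epst" using alpha_bd by (intro mult_left_mono) auto
    also have "\<dots> < sigbar * eps1" using a1 beta_bd(1) eps_pos by (smt (verit) mult_pos_pos)
    also have "\<dots> \<le> 1 * eps1" using sig0 eps_pos by (intro mult_right_mono) (auto simp: sigbar_def)
    finally have "(2 * alpha * kappa) * eps1 < 1 * eps1" by (simp add: mult_ac)
    then have "2 * alpha * kappa < 1" using eps_pos by (simp only: mult_less_cancel_right_pos)
    then show ?thesis using muL by (simp add: kappa_def field_simps)
  qed

  \<comment> \<open>The averaged objective and the modified third error\<close>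
  have S: "sandwiched mu L (f i) (G i)" for i
    by (rule sandwiched_if_hessian_bounds[OF grad hess hess_bounds])
  have SF: "sandwiched mu L F g"
    unfolding F_def g_def N_def by (rule sandwiched_mean[OF S])
  have crit: "g xstar = 0"
    by (rule sandwiched_minimizer_critical[OF SF L]) (use minimizer in \<open>simp add: F_def\<close>)
  note gap = SF muL(1) L crit
  define \<Phi> where "\<Phi> = (\<lambda>t. sqrt N * gap_dist L F xstar (xbar t))"

  have Hinv: "H i z *v (matrix_inv (H i z) *v b) = b" "norm (matrix_inv (H i z) *v b) \<le> 1 / mu * norm b" for i z b
    using coercive_matrix_inv[OF muL(1) hess_bounds(1)] by (simp_all add: divide_inverse mult.commute)

  \<comment> \<open>Evolution of the averages\<close>
  have xbar_mean: "xbar t = (1 / real CARD('n)) *\<^sub>R (\<Sum>j\<in>UNIV. x t j)" for t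
    by (simp add: xbar_def N_def)
  have ybar_mean: "ybar t = (1 / real CARD('n)) *\<^sub>R (\<Sum>j\<in>UNIV. y t j)" for t
    by (simp add: ybar_def N_def)
  define mean where "mean = (\<lambda>Z :: 'n \<Rightarrow> real^'p. (1 / N) *\<^sub>R (\<Sum>j\<in>UNIV. Z j))"
  have mean_le: "sqrt N * norm (mean Z) \<le> frob Z" for Z
    unfolding mean_def N_def by (rule frob_mean_le)
  have center_le: "frob (\<lambda>i. Z i - mean Z) \<le> frob Z" for Z
    unfolding mean_def N_def by (rule frob_centered_le)

  have xbar_step: "xbar (Suc t) = xbar t - alpha *\<^sub>R mean (d t) + beta *\<^sub>R mean (v t)" for t
    unfolding xbar_def mean_def x_rec sum.distrib sum_subtractf sum_mixing[OF W_cols]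
    by (simp add: scaleR_right.sum[symmetric] scaleR_add_right scaleR_diff_right mult.commute)
  have ybar_step: "ybar (Suc t) = ybar t + mean (\<lambda>i. G i (x (Suc t) i) - G i (x t i))" for t
    unfolding ybar_def mean_def y_rec sum.distrib sum_mixing[OF W_cols]
    by (simp add: scaleR_add_right)
  \<comment> \<open>Gradient tracking: unit column sums preserve the average of \<open>y\<close>, so
    the increments telescope from the initialization \<open>y 0 i = G i (x 0 i)\<close>.\<close>
  have ybar: "ybar t = mean (\<lambda>i. G i (x t i))" for t
  proof (induction t)
    case 0
    show ?case by (simp add: ybar_def mean_def y_init)
  next
    case (Suc t)
    then show ?case unfolding ybar_step by (simp add: mean_def sum_subtractf scaleR_diff_right)
  qed
  have ybar_g: "sqrt N * norm (ybar t - g (xbar t)) \<le> L * e1 t" for t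
  proof -
    have "ybar t - g (xbar t) = mean (\<lambda>i. G i (x t i) - G i (xbar t))"
      by (simp add: ybar mean_def g_def sum_subtractf scaleR_diff_right)
    then have "sqrt N * norm (ybar t - g (xbar t)) \<le> frob (\<lambda>i. G i (x t i) - G i (xbar t))"
      using mean_le by simp
    also have "\<dots> \<le> L * e1 t" unfolding e1_def using L lipschitz by (intro frob_le_mult) auto
    finally show ?thesis .
  qed
  \<comment> \<open>At time 0 the value 0 assigned to \<open>e4\<close> agrees with
    \<open>v 0 = 0\<close>.\<close>
  have e4: "e4 t = frob (v t)" for t
    by (cases t) (auto simp: e4_def v_init v_rec frob_def)

  \<comment> \<open>The entrywise error recursion\<close>
  have D: "frob (d t) \<le> kappa * e1 t + e2 t / mu + kappa * \<Phi> t" for t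
  proof -
    have "frob (d t) \<le> 1 / mu * frob (y t)"
      unfolding d_def using Hinv(2) muL by (intro frob_le_mult) auto
    \<comment> \<open>Three contributions to \<open>y\<close>: its deviation from
      \<open>ybar\<close>, the gap between \<open>ybar\<close> and the gradient \<open>g\<close> at
      the average, and that gradient itself.\<close>
    also have "frob (y t) \<le> e2 t + sqrt N * norm (ybar t)"
      using frob_add_le[of "\<lambda>i. y t i - ybar t" "\<lambda>i. ybar t"] frob_const[where 'n = 'n and c = "ybar t"]
      by (simp add: e2_def N_def)
    also have "sqrt N * norm (ybar t) \<le> sqrt N * (norm (ybar t - g (xbar t)) + norm (g (xbar t)))"
      using N norm_triangle_sub[of "ybar t" "g (xbar t)"] by (intro mult_left_mono) (auto simp: add.commute)
    also have "\<dots> \<le> L * e1 t + L * \<Phi> t"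
    proof -
      have "sqrt N * norm (g (xbar t)) \<le> sqrt N * (L * gap_dist L F xstar (xbar t))"
        using N norm_gradient_le_gap_dist[OF gap] by (intro mult_left_mono) auto
      also have "\<dots> = L * \<Phi> t" by (simp add: \<Phi>_def)
      finally show ?thesis using ybar_g[of t] by (simp add: distrib_left)
    qed
    finally have "frob (d t) \<le> 1 / mu * (e2 t + (L * e1 t + L * \<Phi> t))"
      using muL by (simp add: divide_right_mono)
    then show ?thesis by (simp add: kappa_def algebra_simps add_divide_distrib)
  qed
  have input: "frob (\<lambda>i. - (alpha *\<^sub>R d t i) + beta *\<^sub>R v t i)
      \<le> alpha * kappa * e1 t + alpha / mu * e2 t + alpha * kappa * \<Phi> t + beta * e4 t" for t
  proof -
    have "frob (\<lambda>i. (- alpha) *\<^sub>R d t i + beta *\<^sub>R v t i) \<le> alpha * frob (d t) + beta * e4 t"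
      using frob_add_le[of "\<lambda>i. (- alpha) *\<^sub>R d t i" "\<lambda>i. beta *\<^sub>R v t i"] alpha_bd(1) beta_bd(1)
      unfolding frob_scaleR e4 by simp
    also have "alpha * frob (d t) \<le> alpha * (kappa * e1 t + e2 t / mu + kappa * \<Phi> t)"
      using D alpha_bd(1) by (intro mult_left_mono) auto
    finally show ?thesis by (simp add: algebra_simps)
  qed

  have E1: "e1 (Suc t) \<le> (sig + alpha * kappa) * e1 t + alpha / mu * e2 t + alpha * kappa * \<Phi> t + beta * e4 t" for t
  proof -
    define Z where "Z = (\<lambda>i. - (alpha *\<^sub>R d t i) + beta *\<^sub>R v t i)"
    have mZ: "mean Z = - (alpha *\<^sub>R mean (d t)) + beta *\<^sub>R mean (v t)"
      by (simp add: mean_def Z_def sum.distrib sum_negf sum_subtractf scaleR_right.sum[symmetric] scaleR_add_right scaleR_diff_right mult.commute)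
    have "x (Suc t) i - xbar (Suc t) = (\<Sum>j\<in>UNIV. (W - (\<chi> i j. 1 / N)) $ i $ j *\<^sub>R (x t j - xbar t)) + (Z i - mean Z)" for i
      unfolding N_def mixing_deviation(1)[OF W_rows xbar_mean] xbar_step x_rec mZ by (simp add: Z_def)
    then have "e1 (Suc t) \<le> frob (\<lambda>i. \<Sum>j\<in>UNIV. (W - (\<chi> i j. 1 / N)) $ i $ j *\<^sub>R (x t j - xbar t)) + frob (\<lambda>i. Z i - mean Z)"
      unfolding e1_def by (simp only: frob_add_le)
    also have "\<dots> \<le> sig * e1 t + frob Z"
      unfolding sig_def e1_def by (intro add_mono frob_matrix_action_le center_le)
    finally show ?thesis using input[of t] unfolding Z_def by (simp add: algebra_simps)
  qed
  \<comment> \<open>Precedes \<open>E2\<close>, where the gradient increments are bounded by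
    \<open>L\<close> times this displacement; the second row of \<open>M\<close> is \<open>L\<close>
    times the fourth plus \<open>sig\<close> on the diagonal, as
    \<open>L / mu = kappa\<close>.\<close>
  have E4: "e4 (Suc t) \<le> (vsig + alpha * kappa) * e1 t + alpha / mu * e2 t + alpha * kappa * \<Phi> t + beta * e4 t" for t
  proof -
    define Z where "Z = (\<lambda>i. - (alpha *\<^sub>R d t i) + beta *\<^sub>R v t i)"
    have "v (Suc t) i = (\<Sum>j\<in>UNIV. (W - (\<chi> i j. if i = j then 1 else 0)) $ i $ j *\<^sub>R (x t j - xbar t)) + Z i" for i
      unfolding mixing_deviation(2)[OF W_rows xbar_mean] v_rec x_rec by (simp add: Z_def)
    then have "v (Suc t) = (\<lambda>i. (\<Sum>j\<in>UNIV. (W - (\<chi> i j. if i = j then 1 else 0)) $ i $ j *\<^sub>R (x t j - xbar t)) + Z i)"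
      by blast
    then have "e4 (Suc t) \<le> frob (\<lambda>i. \<Sum>j\<in>UNIV. (W - (\<chi> i j. if i = j then 1 else 0)) $ i $ j *\<^sub>R (x t j - xbar t)) + frob Z"
      unfolding e4 by (simp only: frob_add_le)
    also have "\<dots> \<le> vsig * e1 t + frob Z"
      unfolding vsig_def e1_def by (intro add_mono frob_matrix_action_le order_refl)
    finally show ?thesis using input[of t] unfolding Z_def by (simp add: algebra_simps)
  qed
  have E2: "e2 (Suc t) \<le> L * (vsig + alpha * kappa) * e1 t + (sig + alpha * kappa) * e2 t
      + L * alpha * kappa * \<Phi> t + L * beta * e4 t" for t
  proof -
    define Z where "Z = (\<lambda>i. G i (x (Suc t) i) - G i (x t i))"
    have "y (Suc t) i - ybar (Suc t) = (\<Sum>j\<in>UNIV. (W - (\<chi> i j. 1 / N)) $ i $ j *\<^sub>R (y t j - ybar t)) + (Z i - mean Z)" for i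
      unfolding N_def mixing_deviation(1)[OF W_rows ybar_mean] ybar_step y_rec by (simp add: Z_def)
    then have "e2 (Suc t) \<le> frob (\<lambda>i. \<Sum>j\<in>UNIV. (W - (\<chi> i j. 1 / N)) $ i $ j *\<^sub>R (y t j - ybar t)) + frob (\<lambda>i. Z i - mean Z)"
      unfolding e2_def by (simp only: frob_add_le)
    also have "\<dots> \<le> sig * e2 t + frob Z"
      unfolding sig_def e2_def by (intro add_mono frob_matrix_action_le center_le)
    also have "frob Z \<le> L * e4 (Suc t)"
      unfolding e4 Z_def using L lipschitz by (intro frob_le_mult) (auto simp: v_rec)
    also have "L * e4 (Suc t) \<le> L * ((vsig + alpha * kappa) * e1 t + alpha / mu * e2 t + alpha * kappa * \<Phi> t + beta * e4 t)"
      using E4 L by (intro mult_left_mono) auto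
    finally show ?thesis by (simp add: kappa_def algebra_simps)
  qed
  have E3: "\<Phi> (Suc t) \<le> alpha * kappa * e1 t + alpha / mu * e2 t + (1 - alpha / kappa) * \<Phi> t + beta * e4 t" for t
  proof -
    \<comment> \<open>Newton directions for the common vector \<open>g (xbar t)\<close> instead of
      the tracked \<open>y t i\<close>; \<open>sector_mean\<close> needs one vector shared by all
      agents.\<close>
    define u where "u = (\<lambda>i. matrix_inv (H i (x t i)) *v g (xbar t))"
    have "0 \<le> (g (xbar t) - mu *\<^sub>R u i) \<bullet> (L *\<^sub>R u i - g (xbar t))" for i
      using hessian_sector[OF S[of i] muL(2) hess[of i "x t i"], of "u i"] by (simp add: u_def Hinv(1))
    then have sec: "0 \<le> (g (xbar t) - mu *\<^sub>R mean u) \<bullet> (L *\<^sub>R mean u - g (xbar t))"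
      by (rule sector_mean) (use muL L in \<open>auto simp: mean_def N_def\<close>)
    \<comment> \<open>Everything in the average step besides the ideal direction
      \<open>mean u\<close>; it is absorbed by the Lipschitz bound on
      \<open>gap_dist\<close>.\<close>
    define k where "k = (- alpha) *\<^sub>R mean (\<lambda>i. d t i - u i) + beta *\<^sub>R mean (v t)"
    have xb: "xbar (Suc t) = (xbar t - alpha *\<^sub>R mean u) + k"
      unfolding xbar_step k_def by (simp add: mean_def sum_subtractf algebra_simps)
    \<comment> \<open>Only \<open>e1\<close> and \<open>e2\<close> enter, so \<open>\<Phi>\<close>
      itself is left with the contraction factor alone.\<close>
    have du: "frob (\<lambda>i. d t i - u i) \<le> 1 / mu * (e2 t + L * e1 t)"
    proof -
      have "frob (\<lambda>i. d t i - u i) \<le> 1 / mu * frob (\<lambda>i. y t i - g (xbar t))"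
        using Hinv(2) muL unfolding d_def u_def matrix_vector_mult_diff_distrib[symmetric]
        by (intro frob_le_mult) auto
      also have "frob (\<lambda>i. y t i - g (xbar t)) \<le> e2 t + sqrt N * norm (ybar t - g (xbar t))"
        using frob_add_le[of "\<lambda>i. y t i - ybar t" "\<lambda>i. ybar t - g (xbar t)"]
          frob_const[where 'n = 'n and c = "ybar t - g (xbar t)"]
        by (simp add: e2_def N_def)
      also have "\<dots> \<le> e2 t + L * e1 t" using ybar_g by simp
      finally show ?thesis using muL by (simp add: divide_right_mono)
    qed
    have "norm k \<le> alpha * norm (mean (\<lambda>i. d t i - u i)) + beta * norm (mean (v t))"
      unfolding k_def using norm_triangle_ineq[of "(- alpha) *\<^sub>R mean (\<lambda>i. d t i - u i)" "beta *\<^sub>R mean (v t)"]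
        alpha_bd(1) beta_bd(1) by simp
    then have "sqrt N * norm k \<le> sqrt N * (alpha * norm (mean (\<lambda>i. d t i - u i)) + beta * norm (mean (v t)))"
      using N by (intro mult_left_mono) auto
    also have "\<dots> = alpha * (sqrt N * norm (mean (\<lambda>i. d t i - u i))) + beta * (sqrt N * norm (mean (v t)))"
      by (simp add: algebra_simps)
    also have "\<dots> \<le> alpha * (1 / mu * (e2 t + L * e1 t)) + beta * e4 t"
      unfolding e4 using alpha_bd(1) beta_bd(1)
      by (intro add_mono mult_left_mono mean_le order_trans[OF mean_le du]) auto
    finally have k: "sqrt N * norm k \<le> alpha * (1 / mu * (e2 t + L * e1 t)) + beta * e4 t" .
    have "gap_dist L F xstar (xbar (Suc t)) \<le> gap_dist L F xstar (xbar t - alpha *\<^sub>R mean u) + norm k"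
      unfolding xb by (rule gap_dist_Lipschitz[OF gap])
    also have "gap_dist L F xstar (xbar t - alpha *\<^sub>R mean u) \<le> (1 - alpha * mu / L) * gap_dist L F xstar (xbar t)"
      by (rule gap_dist_preconditioned_step[OF gap muL(2) sec alpha_bd(1) small])
    finally have "\<Phi> (Suc t) \<le> sqrt N * ((1 - alpha * mu / L) * gap_dist L F xstar (xbar t) + norm k)"
      unfolding \<Phi>_def using N by (intro mult_left_mono) auto
    also have "\<dots> = (1 - alpha / kappa) * \<Phi> t + sqrt N * norm k"
      by (simp add: \<Phi>_def kappa_def algebra_simps)
    finally show ?thesis using k by (simp add: kappa_def algebra_simps add_divide_distrib)
  qed

  \<comment> \<open>Comparison with the Perron eigenvector and the linear rate\<close>
  define z where "z = (\<lambda>t. vector [e1 t, e2 t, \<Phi> t, e4 t] :: real^4)"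
  have "z (Suc t) $ i \<le> (M *v z t) $ i" for t i
  proof -
    have "\<forall>i. z (Suc t) $ i \<le> (M *v z t) $ i"
      unfolding forall_4 matrix_vector_mult_def vec_lambda_beta sum_4 M_def z_def vector_4
      using E1 E2 E3 E4 by blast
    then show ?thesis by blast
  qed
  then obtain c where c: "\<And>t i. z t $ i \<le> c * r ^ t * w $ i"
    using geometric_decay[OF less_imp_le[OF Mpos] w eig] by blast
  have nonneg: "0 \<le> e1 t" "0 \<le> e2 t" "0 \<le> e3 t" "0 \<le> e4 t" for t
    using N by (simp_all add: e1_def e2_def e3_def e4 frob_nonneg)
  have e3: "e3 t \<le> sqrt kappa * \<Phi> t" for t
  proof -
    have "e3 t \<le> sqrt N * (sqrt (L / mu) * gap_dist L F xstar (xbar t))"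
      unfolding e3_def using N norm_le_gap_dist[OF gap] by (intro mult_left_mono) auto
    also have "\<dots> = sqrt kappa * \<Phi> t" by (simp add: \<Phi>_def kappa_def)
    finally show ?thesis .
  qed
  \<comment> \<open>The factor \<open>sqrt kappa\<close> on the third entry is the cost of returning
    from \<open>\<Phi>\<close> to \<open>e3\<close>; it affects the constant and not the
    rate.\<close>
  define C where "C = c * w $ 1 + c * w $ 2 + sqrt kappa * (c * w $ 3) + c * w $ 4"
  have bound: "norm (vector [e1 t, e2 t, e3 t, e4 t] :: real^4) \<le> C * rho ^ t" for t
  proof -
    have "norm (vector [e1 t, e2 t, e3 t, e4 t] :: real^4) \<le> e1 t + e2 t + e3 t + e4 t"
      using norm_le_l1_cart[of "vector [e1 t, e2 t, e3 t, e4 t] :: real^4"] nonneg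
      by (simp add: sum_4 vector_4)
    also have "\<dots> \<le> c * r ^ t * w $ 1 + c * r ^ t * w $ 2 + sqrt kappa * (c * r ^ t * w $ 3) + c * r ^ t * w $ 4"
    proof -
      have "sqrt kappa * \<Phi> t \<le> sqrt kappa * (c * r ^ t * w $ 3)"
        using c[of t 3] kappa by (intro mult_left_mono) (auto simp: z_def vector_4)
      then show ?thesis
        using c[of t 1] c[of t 2] c[of t 4] e3[of t] unfolding z_def vector_4 by linarith
    qed
    also have "\<dots> = C * rho ^ t" unfolding C_def rho by (simp add: algebra_simps)
    finally show ?thesis .
  qed
  have "(\<lambda>t. C * rho ^ t) \<longlonglongrightarrow> 0"
    using r r1 unfolding rho by (intro tendsto_mult_right_zero LIMSEQ_realpow_zero) auto
  then have "(\<lambda>t. vector [e1 t, e2 t, e3 t, e4 t] :: real^4) \<longlonglongrightarrow> 0"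
    by (rule Lim_null_comparison[rotated]) (simp add: bound)
  then show ?thesis using r1 rho bound by blast
qed

end
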